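(* Let $G$ be a compact group, let $\Phi$ be an $N$-function, and consider $A_\Phi(G)$ as a Banach algebra under the convolution product. Then the following are equivalent: (i) $A_\Phi(G)$ has a bounded approximate identity; (ii) $A_\Phi(G)$ is unital; (iii) $A_\Phi(G)$ is amenable (as a Banach algebra); (iv) $G$ is finite.
   Context: $G$ carries a fixed Haar measure $\lambda$; measurable functions equal $\lambda$-a.e. are identified. $N$-functions. An $N$-function is a convex even function $\Phi:\mathbb R\to[0,\infty)$ with $\Phi(x)=0$ if and only if $x=0$, $\lim_{x\to0}\Phi(x)/x=0$ and $\lim_{x\to\infty}\Phi(x)/x=\infty$. Its complementary $N$-function is $\Psi(y)=\sup\{x|y|-\Phi(x):x\ge0\}$. Orlicz spaces. For measurable $f:G\to\mathbb C$ put $\rho_\Phi(f)=\int_G\Phi(|f(x)|)\,d\lambda(x)$. Let $M^\Phi(G)=\{f:\rho_\Phi(af)<\infty\text{ for all }a>0\}$ (and similarly $M^\Psi(G)$), $N_\Phi(f)=\inf\{k>0:\rho_\Phi(f/k)\le1\}$, and $\|g\|_\Psi=\sup\{\int_G|fg|\,d\lambda: f\text{ measurable},\ N_\Phi(f)\le1\}$. Convolution: $(f*g)(x)=\int_G f(y)g(y^{-1}x)\,d\lambda(y)$. Write $\check g(x)=g(x^{-1})$. The space $A_\Phi(G)$. It consists of all $u\in C_0(G)$ for which there are sequences $(f_n)\subseteq M^\Phi(G)$, $(g_n)\subseteq M^\Psi(G)$ with $\sum_{n=1}^\infty N_\Phi(f_n)\|g_n\|_\Psi<\infty$ and $u=\sum_{n=1}^\infty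 f_n*\check g_n$. It is a Banach space under the norm $\|u\|_{A_\Phi}=\inf\sum_{n=1}^\infty N_\Phi(f_n)\|g_n\|_\Psi$, the infimum being over all such representations of $u$. For compact $G$, $A_\Phi(G)$ is closed under convolution and is a Banach algebra in the sense that $\|u*v\|_{A_\Phi}\le C\|u\|_{A_\Phi}\|v\|_{A_\Phi}$ for some constant $C>0$ (equivalently, after an equivalent renorming one may take $C=1$). "Bounded" in (i) refers to $\|\cdot\|_{A_\Phi}$. A Banach algebra $A$ is amenable if for every Banach $A$-bimodule $X$, every bounded derivation from $A$ into the dual bimodule $X^*$ is inner. *)

theory Defs
  imports "HOL-Analysis.Analysis" "HOL-Algebra.Module"
begin

section \<open>Haar measure and convolution\<close>

text \<open>
  Topological groups are types of class \<open>topological_group_add\<close>. This is the library's class of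
  arbitrary, possibly non-abelian, topological groups; only the notation is additive. Thus
  \<open>x + y\<close> is the product of \<open>x\<close> and \<open>y\<close>, \<open>- x\<close> is the inverse of \<open>x\<close>, and \<open>0\<close> is the identity.
\<close>

definition haar_measure :: "'a::{topological_group_add, t2_space} measure \<Rightarrow> bool" where
  "haar_measure \<mu> \<longleftrightarrow>
     sets \<mu> = sets borel \<and>
     emeasure \<mu> UNIV \<noteq> 0 \<and>
     (\<forall>x. \<forall>B\<in>sets borel. emeasure \<mu> ((\<lambda>y. x + y) ` B) = emeasure \<mu> B) \<and>
     (\<forall>K. compact K \<longrightarrow> emeasure \<mu> K < \<infinity>) \<and>
     (\<forall>B\<in>sets borel. emeasure \<mu> B = (INF U\<in>{U. open U \<and> B \<subseteq> U}. emeasure \<mu> U)) \<and>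
     (\<forall>U. open U \<longrightarrow> emeasure \<mu> U = (SUP K\<in>{K. compact K \<and> K \<subseteq> U}. emeasure \<mu> K))"

definition convolution ::
  "'a::{topological_group_add, t2_space} measure \<Rightarrow> ('a \<Rightarrow> complex) \<Rightarrow> ('a \<Rightarrow> complex) \<Rightarrow> 'a \<Rightarrow> complex"
  where "convolution \<mu> f g = (\<lambda>x. \<integral>y. f y * g (- y + x) \<partial>\<mu>)"

definition inv_reflect :: "('a::group_add \<Rightarrow> complex) \<Rightarrow> 'a \<Rightarrow> complex" where
  "inv_reflect g = (\<lambda>x. g (- x))"

definition C_0 :: "('a::topological_space \<Rightarrow> complex) set" where
  "C_0 = {u. continuous_on UNIV u \<and> (\<forall>\<epsilon>>0. compact {x. \<epsilon> \<le> cmod (u x)})}"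


section \<open>N-functions and Orlicz spaces\<close>

definition N_function :: "(real \<Rightarrow> real) \<Rightarrow> bool" where
  "N_function \<Phi> \<longleftrightarrow>
     convex_on UNIV \<Phi> \<and>
     (\<forall>x. \<Phi> (- x) = \<Phi> x) \<and>
     (\<forall>x. 0 \<le> \<Phi> x) \<and>
     (\<forall>x. \<Phi> x = 0 \<longleftrightarrow> x = 0) \<and>
     ((\<lambda>x. \<Phi> x / x) \<longlongrightarrow> 0) (at 0) \<and>
     filterlim (\<lambda>x. \<Phi> x / x) at_top at_top"

definition complementary :: "(real \<Rightarrow> real) \<Rightarrow> real \<Rightarrow> real" where
  "complementary \<Phi> y = (SUP x\<in>{0..}. x * \<bar>y\<bar> - \<Phi> x)"

definition modular :: "'a measure \<Rightarrow> (real \<Rightarrow> real) \<Rightarrow> ('a \<Rightarrow> complex) \<Rightarrow> ennreal" where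
  "modular \<mu> \<Phi> f = (\<integral>\<^sup>+x. ennreal (\<Phi> (cmod (f x))) \<partial>\<mu>)"

text \<open>
  Elements of the Orlicz spaces are represented by measurable functions. The norms below do not
  distinguish functions that agree almost everywhere, and neither do the convolutions of such
  functions.
\<close>

definition M_space :: "'a measure \<Rightarrow> (real \<Rightarrow> real) \<Rightarrow> ('a \<Rightarrow> complex) set" where
  "M_space \<mu> \<Phi> =
     {f \<in> borel_measurable \<mu>. \<forall>a>0. modular \<mu> \<Phi> (\<lambda>x. of_real a * f x) < \<infinity>}"

text \<open>
  The norms take values in \<open>ennreal\<close>, so that a function outside the Orlicz space has Luxemburg
  norm \<open>\<infinity>\<close> (the infimum of the empty set) and does not enter the supremum in \<open>orlicz_norm\<close>.
\<close>

definition luxemburg_norm :: "'a measure \<Rightarrow> (real \<Rightarrow> real) \<Rightarrow> ('a \<Rightarrow> complex) \<Rightarrow> ennreal" where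
  "luxemburg_norm \<mu> \<Phi> f = Inf {ennreal k |k. 0 < k \<and> modular \<mu> \<Phi> (\<lambda>x. f x / of_real k) \<le> 1}"

text \<open>
  \<open>orlicz_norm \<mu> \<Phi>\<close> is the Orlicz norm usually denoted by the complementary function
  \<open>\<Psi> = complementary \<Phi>\<close>: the supremum runs over the unit ball for \<open>\<Phi>\<close>.
\<close>

definition orlicz_norm :: "'a measure \<Rightarrow> (real \<Rightarrow> real) \<Rightarrow> ('a \<Rightarrow> complex) \<Rightarrow> ennreal" where
  "orlicz_norm \<mu> \<Phi> g =
     (SUP f\<in>{f \<in> borel_measurable \<mu>. luxemburg_norm \<mu> \<Phi> f \<le> 1}.
        \<integral>\<^sup>+x. ennreal (cmod (f x * g x)) \<partial>\<mu>)"


section \<open>Complex normed spaces, Banach bimodules and amenability\<close>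

text \<open>
  Banach spaces carry an explicit carrier set, because amenability quantifies over them. They extend
  the record \<open>module\<close>, with the complex numbers as ring of scalars. For a plain vector space
  the fields \<open>mult\<close> and \<open>one\<close> inherited from \<open>ring\<close> have no meaning. For an algebra \<open>mult\<close> is the
  product, but \<open>one\<close> still has no meaning, since the algebra need not be unital.
\<close>

record 'b normed_cmodule = "(complex, 'b) module" +
  vnorm :: "'b \<Rightarrow> real"

definition complex_ring :: "complex ring" where
  "complex_ring = \<lparr>carrier = UNIV, mult = (*), one = 1, zero = 0, add = (+)\<rparr>"

locale complex_normed_space = Module.module complex_ring X
  for X :: "('b, 'm) normed_cmodule_scheme" (structure) +
  assumes vnorm_nonneg: "x \<in> carrier X \<Longrightarrow> 0 \<le> vnorm X x"
    and vnorm_eq_0: "x \<in> carrier X \<Longrightarrow> vnorm X x = 0 \<longleftrightarrow> x = \<zero>\<^bsub>X\<^esub>"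
    and vnorm_triangle:
      "\<lbrakk>x \<in> carrier X; y \<in> carrier X\<rbrakk> \<Longrightarrow> vnorm X (x \<oplus>\<^bsub>X\<^esub> y) \<le> vnorm X x + vnorm X y"
    and vnorm_smult: "x \<in> carrier X \<Longrightarrow> vnorm X (c \<odot>\<^bsub>X\<^esub> x) = cmod c * vnorm X x"

locale complex_banach_space = complex_normed_space +
  assumes complete:
    "\<lbrakk>\<And>n::nat. s n \<in> carrier X;
      \<And>\<epsilon>. \<epsilon> > 0 \<Longrightarrow> \<exists>N. \<forall>m\<ge>N. \<forall>n\<ge>N. vnorm X (s m \<ominus>\<^bsub>X\<^esub> s n) < \<epsilon>\<rbrakk>
     \<Longrightarrow> \<exists>x\<in>carrier X. (\<lambda>n. vnorm X (s n \<ominus>\<^bsub>X\<^esub> x)) \<longlonglongrightarrow> 0"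

text \<open>\<open>l a x\<close> is the left action of \<open>a\<close> on \<open>x\<close>, and \<open>r x a\<close> is the right action.\<close>

locale banach_bimodule = complex_banach_space X
  for A :: "('c, 'n) normed_cmodule_scheme"
    and X :: "('b, 'm) normed_cmodule_scheme"
    and l :: "'c \<Rightarrow> 'b \<Rightarrow> 'b"
    and r :: "'b \<Rightarrow> 'c \<Rightarrow> 'b" +
  assumes l_closed: "\<lbrakk>a \<in> carrier A; x \<in> carrier X\<rbrakk> \<Longrightarrow> l a x \<in> carrier X"
    and r_closed: "\<lbrakk>a \<in> carrier A; x \<in> carrier X\<rbrakk> \<Longrightarrow> r x a \<in> carrier X"
    and l_add_left: "\<lbrakk>a \<in> carrier A; b \<in> carrier A; x \<in> carrier X\<rbrakk>
      \<Longrightarrow> l (a \<oplus>\<^bsub>A\<^esub> b) x = l a x \<oplus>\<^bsub>X\<^esub> l b x"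
    and l_add_right: "\<lbrakk>a \<in> carrier A; x \<in> carrier X; y \<in> carrier X\<rbrakk>
      \<Longrightarrow> l a (x \<oplus>\<^bsub>X\<^esub> y) = l a x \<oplus>\<^bsub>X\<^esub> l a y"
    and l_smult_left: "\<lbrakk>a \<in> carrier A; x \<in> carrier X\<rbrakk> \<Longrightarrow> l (c \<odot>\<^bsub>A\<^esub> a) x = c \<odot>\<^bsub>X\<^esub> l a x"
    and l_smult_right: "\<lbrakk>a \<in> carrier A; x \<in> carrier X\<rbrakk> \<Longrightarrow> l a (c \<odot>\<^bsub>X\<^esub> x) = c \<odot>\<^bsub>X\<^esub> l a x"
    and r_add_left: "\<lbrakk>a \<in> carrier A; x \<in> carrier X; y \<in> carrier X\<rbrakk>
      \<Longrightarrow> r (x \<oplus>\<^bsub>X\<^esub> y) a = r x a \<oplus>\<^bsub>X\<^esub> r y a"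
    and r_add_right: "\<lbrakk>a \<in> carrier A; b \<in> carrier A; x \<in> carrier X\<rbrakk>
      \<Longrightarrow> r x (a \<oplus>\<^bsub>A\<^esub> b) = r x a \<oplus>\<^bsub>X\<^esub> r x b"
    and r_smult_left: "\<lbrakk>a \<in> carrier A; x \<in> carrier X\<rbrakk> \<Longrightarrow> r (c \<odot>\<^bsub>X\<^esub> x) a = c \<odot>\<^bsub>X\<^esub> r x a"
    and r_smult_right: "\<lbrakk>a \<in> carrier A; x \<in> carrier X\<rbrakk> \<Longrightarrow> r x (c \<odot>\<^bsub>A\<^esub> a) = c \<odot>\<^bsub>X\<^esub> r x a"
    and l_assoc: "\<lbrakk>a \<in> carrier A; b \<in> carrier A; x \<in> carrier X\<rbrakk>
      \<Longrightarrow> l (a \<otimes>\<^bsub>A\<^esub> b) x = l a (l b x)"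
    and r_assoc: "\<lbrakk>a \<in> carrier A; b \<in> carrier A; x \<in> carrier X\<rbrakk>
      \<Longrightarrow> r x (a \<otimes>\<^bsub>A\<^esub> b) = r (r x a) b"
    and l_r_assoc: "\<lbrakk>a \<in> carrier A; b \<in> carrier A; x \<in> carrier X\<rbrakk>
      \<Longrightarrow> l a (r x b) = r (l a x) b"
    and l_bounded: "\<exists>K. \<forall>a\<in>carrier A. \<forall>x\<in>carrier X. vnorm X (l a x) \<le> K * vnorm A a * vnorm X x"
    and r_bounded: "\<exists>K. \<forall>a\<in>carrier A. \<forall>x\<in>carrier X. vnorm X (r x a) \<le> K * vnorm A a * vnorm X x"

text \<open>
  The dual space consists of the bounded linear functionals on the carrier, made \<open>undefined\<close>
  outside of it so that equality of functionals is equality of functions.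
\<close>

definition dual_carrier :: "('b, 'm) normed_cmodule_scheme \<Rightarrow> ('b \<Rightarrow> complex) set" where
  "dual_carrier X = {\<phi> \<in> extensional (carrier X).
     (\<forall>x\<in>carrier X. \<forall>y\<in>carrier X. \<phi> (x \<oplus>\<^bsub>X\<^esub> y) = \<phi> x + \<phi> y) \<and>
     (\<forall>c. \<forall>x\<in>carrier X. \<phi> (c \<odot>\<^bsub>X\<^esub> x) = c * \<phi> x) \<and>
     (\<exists>K. \<forall>x\<in>carrier X. cmod (\<phi> x) \<le> K * vnorm X x)}"

definition dual :: "('b, 'm) normed_cmodule_scheme \<Rightarrow> ('b \<Rightarrow> complex) normed_cmodule" where
  "dual X = \<lparr>carrier = dual_carrier X, mult = undefined, one = undefined,
     zero = (\<lambda>x\<in>carrier X. 0),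
     add = (\<lambda>\<phi> \<psi>. \<lambda>x\<in>carrier X. \<phi> x + \<psi> x),
     smult = (\<lambda>c \<phi>. \<lambda>x\<in>carrier X. c * \<phi> x),
     vnorm = (\<lambda>\<phi>. SUP x\<in>{x \<in> carrier X. vnorm X x \<le> 1}. cmod (\<phi> x))\<rparr>"

definition dual_left ::
  "('b, 'm) normed_cmodule_scheme \<Rightarrow> ('b \<Rightarrow> 'c \<Rightarrow> 'b) \<Rightarrow> 'c \<Rightarrow> ('b \<Rightarrow> complex) \<Rightarrow> 'b \<Rightarrow> complex"
  where "dual_left X r a \<phi> = (\<lambda>x\<in>carrier X. \<phi> (r x a))"

definition dual_right ::
  "('b, 'm) normed_cmodule_scheme \<Rightarrow> ('c \<Rightarrow> 'b \<Rightarrow> 'b) \<Rightarrow> ('b \<Rightarrow> complex) \<Rightarrow> 'c \<Rightarrow> 'b \<Rightarrow> complex"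
  where "dual_right X l \<phi> a = (\<lambda>x\<in>carrier X. \<phi> (l a x))"

definition bounded_derivation ::
  "('c, 'n) normed_cmodule_scheme \<Rightarrow> ('b, 'm) normed_cmodule_scheme \<Rightarrow>
   ('c \<Rightarrow> 'b \<Rightarrow> 'b) \<Rightarrow> ('b \<Rightarrow> 'c \<Rightarrow> 'b) \<Rightarrow> ('c \<Rightarrow> 'b) \<Rightarrow> bool" where
  "bounded_derivation A Y l r D \<longleftrightarrow>
     D \<in> carrier A \<rightarrow> carrier Y \<and>
     (\<forall>a\<in>carrier A. \<forall>b\<in>carrier A. D (a \<oplus>\<^bsub>A\<^esub> b) = D a \<oplus>\<^bsub>Y\<^esub> D b) \<and>
     (\<forall>c. \<forall>a\<in>carrier A. D (c \<odot>\<^bsub>A\<^esub> a) = c \<odot>\<^bsub>Y\<^esub> D a) \<and>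
     (\<exists>K. \<forall>a\<in>carrier A. vnorm Y (D a) \<le> K * vnorm A a) \<and>
     (\<forall>a\<in>carrier A. \<forall>b\<in>carrier A. D (a \<otimes>\<^bsub>A\<^esub> b) = l a (D b) \<oplus>\<^bsub>Y\<^esub> r (D a) b)"

definition inner_derivation ::
  "('c, 'n) normed_cmodule_scheme \<Rightarrow> ('b, 'm) normed_cmodule_scheme \<Rightarrow>
   ('c \<Rightarrow> 'b \<Rightarrow> 'b) \<Rightarrow> ('b \<Rightarrow> 'c \<Rightarrow> 'b) \<Rightarrow> ('c \<Rightarrow> 'b) \<Rightarrow> bool" where
  "inner_derivation A Y l r D \<longleftrightarrow>
     (\<exists>y\<in>carrier Y. \<forall>a\<in>carrier A. D a = l a y \<ominus>\<^bsub>Y\<^esub> r y a)"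

text \<open>
  A formula of HOL cannot quantify over all types, so amenability is relative to a type \<open>'b\<close> of
  which the carriers of the bimodules are subsets. It is a weak condition if \<open>'b\<close> is too small;
  see \<open>bimodule_univ\<close> below.
\<close>

definition amenable :: "'b itself \<Rightarrow> ('c, 'n) normed_cmodule_scheme \<Rightarrow> bool" where
  "amenable (_ :: 'b itself) A \<longleftrightarrow>
     (\<forall>(X :: 'b normed_cmodule) l r. banach_bimodule A X l r \<longrightarrow>
        (\<forall>D. bounded_derivation A (dual X) (dual_left X r) (dual_right X l) D \<longrightarrow>
             inner_derivation A (dual X) (dual_left X r) (dual_right X l) D))"

text \<open>
  For algebras whose elements have type \<open>'c\<close>. The first summand contains the dual space of the
  algebra, and the second summand is arbitrary: a theorem about
  \<open>amenable TYPE(('c, 'x) bimodule_univ)\<close> with \<open>'x\<close> a type variable covers the Banach bimodules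
  living in any type whatsoever.
\<close>

type_synonym ('c, 'x) bimodule_univ = "('c \<Rightarrow> complex) + 'x"

definition unital :: "('c, 'n) normed_cmodule_scheme \<Rightarrow> bool" where
  "unital A \<longleftrightarrow> (\<exists>e\<in>carrier A. \<forall>a\<in>carrier A. e \<otimes>\<^bsub>A\<^esub> a = a \<and> a \<otimes>\<^bsub>A\<^esub> e = a)"

text \<open>
  A net in the algebra is given by the filter it generates; conversely every proper filter is
  generated by a net.
\<close>

definition has_bounded_approximate_identity :: "('c, 'n) normed_cmodule_scheme \<Rightarrow> bool" where
  "has_bounded_approximate_identity A \<longleftrightarrow>
     (\<exists>F K. F \<noteq> bot \<and>
        (\<forall>\<^sub>F e in F. e \<in> carrier A \<and> vnorm A e \<le> K) \<and>
        (\<forall>a\<in>carrier A.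
           ((\<lambda>e. vnorm A (e \<otimes>\<^bsub>A\<^esub> a \<ominus>\<^bsub>A\<^esub> a)) \<longlongrightarrow> 0) F \<and>
           ((\<lambda>e. vnorm A (a \<otimes>\<^bsub>A\<^esub> e \<ominus>\<^bsub>A\<^esub> a)) \<longlongrightarrow> 0) F))"


section \<open>The convolution algebra A_Phi\<close>

text \<open>
  By the Hoelder inequality the finiteness of \<open>rep_cost\<close> makes the series in \<open>represents\<close>
  converge absolutely and uniformly, so its pointwise sum is also its sum in \<open>C_0\<close>.
\<close>

definition rep_cost ::
  "'a measure \<Rightarrow> (real \<Rightarrow> real) \<Rightarrow> (nat \<Rightarrow> 'a \<Rightarrow> complex) \<Rightarrow> (nat \<Rightarrow> 'a \<Rightarrow> complex) \<Rightarrow> ennreal" where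
  "rep_cost \<mu> \<Phi> f g = (\<Sum>n. luxemburg_norm \<mu> \<Phi> (f n) * orlicz_norm \<mu> \<Phi> (g n))"

definition represents ::
  "'a::{topological_group_add, t2_space} measure \<Rightarrow> (real \<Rightarrow> real) \<Rightarrow>
   (nat \<Rightarrow> 'a \<Rightarrow> complex) \<Rightarrow> (nat \<Rightarrow> 'a \<Rightarrow> complex) \<Rightarrow> ('a \<Rightarrow> complex) \<Rightarrow> bool" where
  "represents \<mu> \<Phi> f g u \<longleftrightarrow>
     (\<forall>n. f n \<in> M_space \<mu> \<Phi>) \<and>
     (\<forall>n. g n \<in> M_space \<mu> (complementary \<Phi>)) \<and>
     rep_cost \<mu> \<Phi> f g < \<infinity> \<and>
     (\<forall>x. (\<lambda>n. convolution \<mu> (f n) (inv_reflect (g n)) x) sums u x)"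

definition A_Phi ::
  "'a::{topological_group_add, t2_space} measure \<Rightarrow> (real \<Rightarrow> real) \<Rightarrow> ('a \<Rightarrow> complex) normed_cmodule"
  where
  "A_Phi \<mu> \<Phi> = \<lparr>carrier = {u \<in> C_0. \<exists>f g. represents \<mu> \<Phi> f g u},
     mult = convolution \<mu>, one = undefined,
     zero = (\<lambda>x. 0), add = (\<lambda>u v x. u x + v x), smult = (\<lambda>c u x. c * u x),
     vnorm = (\<lambda>u. enn2real (Inf {rep_cost \<mu> \<Phi> f g |f g. represents \<mu> \<Phi> f g u}))\<rparr>"

end

(*
  A bounded net e with e * a -> a in A_Phi is bounded in the supremum norm, which is dominated by
  the norm of A_Phi. For a = f * f, with f continuous, nonnegative and symmetric, comparing (e * a)(0)
  with a(0) gives |f|_2^2 <= K |f|_1^2, with K independent of f. By Cauchy-Schwarz every neighbourhood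
  of the identity then has measure at least 1/K, hence so does the identity itself, and G is finite.

  Amenability yields the same inequality without an approximate identity: let A_Phi act on C(G)^* on
  one side by convolution and on the other side trivially, and let D send a to evaluation at a. If D is
  implemented by the functional E, then E(xi . a) = xi(a) for all xi in C(G)^*; take xi to be evaluation
  at the identity.

  For finite G, A_Phi is the group algebra, and an average over the group makes derivations inner.
*)

theory Submission
  imports Defs
begin

section \<open>Orlicz spaces\<close>

text \<open>Both routes to finiteness test with f * f rather than with f: a convolution of two
  continuous functions has an obvious representation in \<open>A_Phi\<close>, and for symmetric f
  its value at the identity is the integral of the square. Symmetry has a second task. Haar measure
  is given as left invariant, so convolving on the right by f costs only |f|_1 in the supremum norm
  once f(-y + x) has been rewritten as f(-x + y). In the second route the dual module is the bidual
  of C(G), and D is the canonical embedding of C(G) into it, restricted to the algebra. If E were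
  evaluation at a function e, the identity obtained would say a * e = a; so E acts as a right
  identity in the bidual. Working with the supremum norm makes the action bounded by the L1 norm,
  which is the norm on the right of the desired inequality. Amenability ranges over Banach spaces
  given by carrier sets in one fixed type. Hence C(G)^* is built, shown to be complete and copied
  into that type; this is the purpose of the part on duals.\<close>

lemma N_functionD:
  assumes "N_function \<Phi>"
  shows "convex_on UNIV \<Phi>" "\<Phi> (- x) = \<Phi> x" "0 \<le> \<Phi> x" "\<Phi> x = 0 \<longleftrightarrow> x = 0"
    "filterlim (\<lambda>x. \<Phi> x / x) at_top at_top"
  using assms by (auto simp: N_function_def)

text \<open>Convexity on the segment from 0 to x, with value 0 at 0. It yields both the monotonicity
  of \<open>\<Phi>\<close> and the rescaling estimate behind the finiteness of the Luxemburg
  norm.\<close>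

lemma N_function_scale:
  assumes "N_function \<Phi>" "0 \<le> t" "t \<le> 1"
  shows "\<Phi> (t * x) \<le> t * \<Phi> x"
  using convex_onD[OF N_functionD(1)[OF assms(1)], of t 0 x] assms(2,3)
    N_functionD(4)[OF assms(1), of 0] by simp

lemma N_function_mono:
  assumes "N_function \<Phi>" "0 \<le> x" "x \<le> y"
  shows "\<Phi> x \<le> \<Phi> y"
proof (cases "y = 0")
  case True
  then show ?thesis using assms by simp
next
  case False
  then have "\<Phi> x = \<Phi> (x / y * y)" by simp
  also have "\<dots> \<le> x / y * \<Phi> y"
    using assms False by (intro N_function_scale) auto
  also have "\<dots> \<le> 1 * \<Phi> y"
    using assms False N_functionD(3)[OF assms(1)] by (intro mult_right_mono) auto
  finally show ?thesis by simp
qed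

lemma N_function_measurable:
  assumes "N_function \<Phi>"
  shows "\<Phi> \<in> borel_measurable borel"
  by (intro borel_measurable_continuous_onI convex_on_continuous open_UNIV N_functionD(1) assms)

text \<open>Superlinear growth makes \<open>\<Phi> x\<close> at least x * |y| beyond some R, and
  below R the linear term is at most \<open>max R 0\<close> times |y|. The real-valued
  \<open>SUP\<close> in \<open>complementary\<close> is meaningful only once this bound is
  known.\<close>

lemma complementary_bdd_above:
  assumes "N_function \<Phi>"
  shows "bdd_above ((\<lambda>x. x * \<bar>y\<bar> - \<Phi> x) ` {0..})"
proof -
  have "eventually (\<lambda>x. \<bar>y\<bar> \<le> \<Phi> x / x) at_top"
    using N_functionD(5)[OF assms] by (simp add: filterlim_at_top)
  then obtain R where R: "\<And>x. R \<le> x \<Longrightarrow> \<bar>y\<bar> \<le> \<Phi> x / x"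
    by (auto simp: eventually_at_top_linorder)
  have "x * \<bar>y\<bar> - \<Phi> x \<le> max R 0 * \<bar>y\<bar>" if "0 \<le> x" for x
  proof (cases "R \<le> x \<and> x \<noteq> 0")
    case True
    then have "x * \<bar>y\<bar> \<le> \<Phi> x"
      using R[of x] that by (simp add: field_simps)
    moreover have "0 \<le> max R 0 * \<bar>y\<bar>" by simp
    ultimately show ?thesis by linarith
  next
    case False
    then have "x * \<bar>y\<bar> \<le> max R 0 * \<bar>y\<bar>"
      by (intro mult_right_mono) auto
    then show ?thesis using N_functionD(3)[OF assms, of x] by linarith
  qed
  then show ?thesis by (auto simp: bdd_above_def)
qed

lemma Young_inequality:
  assumes "N_function \<Phi>" "0 \<le> x"
  shows "x * \<bar>y\<bar> \<le> \<Phi> x + complementary \<Phi> y"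
  using cSUP_upper[OF _ complementary_bdd_above[OF assms(1)], of x y] assms(2)
  by (simp add: complementary_def)

lemma complementary_nonneg:
  assumes "N_function \<Phi>"
  shows "0 \<le> complementary \<Phi> y"
  using Young_inequality[OF assms, of 0 y] N_functionD(4)[OF assms, of 0] by simp

lemma complementary_mono:
  assumes "N_function \<Phi>" "\<bar>x\<bar> \<le> \<bar>y\<bar>"
  shows "complementary \<Phi> x \<le> complementary \<Phi> y"
  unfolding complementary_def
proof (rule cSUP_mono)
  show "\<exists>m\<in>{0..}. n * \<bar>x\<bar> - \<Phi> n \<le> m * \<bar>y\<bar> - \<Phi> m" if "n \<in> {0..}" for n
    using that mult_left_mono[OF assms(2), of n] by (intro bexI[of _ n]) auto
qed (use complementary_bdd_above[OF assms(1)] in auto)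

text \<open>On nonnegative arguments the complementary function is monotone, hence Borel. Composing
  with \<open>max 0\<close> extends the monotonicity to the real line without changing the values at
  moduli.\<close>

lemma complementary_measurable:
  assumes "N_function \<Phi>" "g \<in> borel_measurable M"
  shows "(\<lambda>x. complementary \<Phi> (cmod (g x))) \<in> borel_measurable M"
proof -
  have "mono (\<lambda>y. complementary \<Phi> (max 0 y))"
    by (intro monoI complementary_mono assms) auto
  then have "(\<lambda>y. complementary \<Phi> (max 0 y)) \<in> borel_measurable borel"
    by (rule borel_measurable_mono)
  from measurable_compose[OF _ this, of "\<lambda>x. cmod (g x)" M] show ?thesis
    using assms(2) by (simp add: max_def)
qed

text \<open>P is any function that is monotone on the nonnegative reals, so that
  \<open>\<Phi>\<close> and \<open>complementary \<Phi>\<close> are treated alike.\<close>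

lemma bounded_in_M_space:
  assumes "finite_measure M" "f \<in> borel_measurable M" "\<And>x. cmod (f x) \<le> c"
    and mono: "\<And>x y. 0 \<le> x \<Longrightarrow> x \<le> y \<Longrightarrow> P x \<le> P y"
  shows "f \<in> M_space M P"
proof -
  have "modular M P (\<lambda>x. of_real a * f x) < \<infinity>" if "a > 0" for a
  proof -
    have "modular M P (\<lambda>x. of_real a * f x) \<le> (\<integral>\<^sup>+x. ennreal (P (a * c)) \<partial>M)"
      unfolding modular_def
      by (intro nn_integral_mono ennreal_leI mono) (use that assms(3) in \<open>auto simp: norm_mult\<close>)
    also have "\<dots> < \<infinity>"
      using finite_measure.emeasure_finite[OF assms(1)]
      by (auto simp: ennreal_mult_less_top top.not_eq_extremum)
    finally show ?thesis .
  qed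
  then show ?thesis using assms(2) by (simp add: M_space_def)
qed

lemma luxemburg_norm_le:
  assumes "0 < k" "modular M \<Phi> (\<lambda>x. f x / of_real k) \<le> 1"
  shows "luxemburg_norm M \<Phi> f \<le> ennreal k"
  unfolding luxemburg_norm_def by (rule Inf_lower) (use assms in auto)

text \<open>For k at least 1, convexity bounds the modular of f / k by the modular of f divided by
  k; hence the larger of 1 and the modular of f is an admissible k.\<close>

lemma luxemburg_norm_finite:
  assumes "N_function \<Phi>" "f \<in> M_space M \<Phi>"
  shows "luxemburg_norm M \<Phi> f < \<infinity>"
proof -
  have "modular M \<Phi> (\<lambda>x. of_real 1 * f x) < \<infinity>"
    using assms(2) by (simp add: M_space_def del: of_real_1)
  then obtain m where m: "modular M \<Phi> f = ennreal m" "0 \<le> m"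
    by (auto simp: less_top_ennreal)
  define k where "k = max 1 m"
  have k: "1 \<le> k" "m \<le> k" by (auto simp: k_def)
  have "f \<in> borel_measurable M"
    using assms(2) by (simp add: M_space_def)
  then have meas: "(\<lambda>x. \<Phi> (cmod (f x))) \<in> borel_measurable M"
    by (intro measurable_compose[OF _ N_function_measurable[OF assms(1)]]) simp
  have "modular M \<Phi> (\<lambda>x. f x / of_real k) \<le> (\<integral>\<^sup>+x. ennreal (1 / k) * ennreal (\<Phi> (cmod (f x))) \<partial>M)"
    unfolding modular_def
  proof (rule nn_integral_mono)
    fix x
    have "\<Phi> (cmod (f x / of_real k)) \<le> 1 / k * \<Phi> (cmod (f x))"
      using N_function_scale[OF assms(1), of "1 / k" "cmod (f x)"] k by (simp add: norm_divide)
    then show "ennreal (\<Phi> (cmod (f x / of_real k))) \<le> ennreal (1 / k) * ennreal (\<Phi> (cmod (f x)))"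
      using k N_functionD(3)[OF assms(1)] by (simp add: ennreal_leI flip: ennreal_mult)
  qed
  also have "\<dots> = ennreal (1 / k) * ennreal m"
    using meas m by (subst nn_integral_cmult) (auto simp: modular_def)
  also have "\<dots> \<le> 1"
    using k m(2) by (simp add: ennreal_mult'[symmetric])
  finally have "luxemburg_norm M \<Phi> f \<le> ennreal k"
    using k by (intro luxemburg_norm_le) auto
  then show ?thesis using le_less_trans by fastforce
qed

text \<open>Hoelder's inequality for a single admissible k: f / k lies in the unit ball over which
  \<open>orlicz_norm\<close> takes its supremum. The infimum over k is taken in
  \<open>Hoelder_inequality_Orlicz\<close>.\<close>

lemma orlicz_norm_bound:
  assumes "f \<in> borel_measurable M" "g \<in> borel_measurable M"
    and "0 < k" "modular M \<Phi> (\<lambda>x. f x / of_real k) \<le> 1"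
  shows "(\<integral>\<^sup>+x. ennreal (cmod (f x * g x)) \<partial>M) \<le> ennreal k * orlicz_norm M \<Phi> g"
proof -
  let ?h = "\<lambda>x. f x / of_real k"
  have "luxemburg_norm M \<Phi> ?h \<le> 1"
    using luxemburg_norm_le[of 1 M \<Phi> ?h] assms(4) by simp
  then have le: "(\<integral>\<^sup>+x. ennreal (cmod (?h x * g x)) \<partial>M) \<le> orlicz_norm M \<Phi> g"
    unfolding orlicz_norm_def using assms(1) by (intro SUP_upper) auto
  have "(\<integral>\<^sup>+x. ennreal (cmod (f x * g x)) \<partial>M)
      = (\<integral>\<^sup>+x. ennreal k * ennreal (cmod (?h x * g x)) \<partial>M)"
    using assms(3) by (intro nn_integral_cong) (simp add: norm_mult norm_divide flip: ennreal_mult')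
  also have "\<dots> = ennreal k * (\<integral>\<^sup>+x. ennreal (cmod (?h x * g x)) \<partial>M)"
    by (rule nn_integral_cmult) (use assms(1,2) in auto)
  also have "\<dots> \<le> ennreal k * orlicz_norm M \<Phi> g"
    using le by (rule mult_left_mono) simp
  finally show ?thesis .
qed

text \<open>Young's inequality applied to f / k and g splits the integral into two modulars, one at
  most 1 and the other finite by assumption.\<close>

lemma orlicz_norm_finite:
  assumes "N_function \<Phi>" "g \<in> M_space M (complementary \<Phi>)"
  shows "orlicz_norm M \<Phi> g < \<infinity>"
proof -
  have g: "g \<in> borel_measurable M" "modular M (complementary \<Phi>) (\<lambda>x. of_real 1 * g x) < \<infinity>"
    using assms(2) by (simp_all add: M_space_def del: of_real_1)
  let ?c = "modular M (complementary \<Phi>) g"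
  have "orlicz_norm M \<Phi> g \<le> 2 * (1 + ?c)"
    unfolding orlicz_norm_def
  proof (rule SUP_least, clarify)
    fix f :: "'a \<Rightarrow> complex"
    assume f: "f \<in> borel_measurable M" "luxemburg_norm M \<Phi> f \<le> 1"
    \<comment> \<open>An infimum of at most 1 provides admissible k only with some slack above 1;
      choosing k below 2 is the origin of the factor 2 in the bound.\<close>
    have "luxemburg_norm M \<Phi> f < 2"
      using f(2) by (rule le_less_trans) (simp add: one_less_numeral)
    then obtain k where k: "0 < k" "ennreal k < 2" "modular M \<Phi> (\<lambda>x. f x / of_real k) \<le> 1"
      by (auto simp: luxemburg_norm_def Inf_less_iff)
    let ?h = "\<lambda>x. f x / of_real k"
    have "(\<integral>\<^sup>+x. ennreal (cmod (f x * g x)) \<partial>M)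
        \<le> (\<integral>\<^sup>+x. ennreal k * (ennreal (\<Phi> (cmod (?h x))) + ennreal (complementary \<Phi> (cmod (g x)))) \<partial>M)"
    proof (rule nn_integral_mono)
      fix x
      have "cmod (f x * g x) = k * (cmod (?h x) * \<bar>cmod (g x)\<bar>)"
        using k(1) by (simp add: norm_mult norm_divide)
      also have "\<dots> \<le> k * (\<Phi> (cmod (?h x)) + complementary \<Phi> (cmod (g x)))"
        using k(1) Young_inequality[OF assms(1), of "cmod (?h x)" "cmod (g x)"]
        by (intro mult_left_mono) auto
      finally show "ennreal (cmod (f x * g x))
          \<le> ennreal k * (ennreal (\<Phi> (cmod (?h x))) + ennreal (complementary \<Phi> (cmod (g x))))"
        using k(1) N_functionD(3)[OF assms(1)] complementary_nonneg[OF assms(1)]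
        by (simp add: ennreal_leI flip: ennreal_mult ennreal_plus)
    qed
    also have "\<dots> = ennreal k * (modular M \<Phi> ?h + ?c)"
    proof -
      have [measurable]: "(\<lambda>x. \<Phi> (cmod (?h x))) \<in> borel_measurable M"
        using f(1) by (intro measurable_compose[OF _ N_function_measurable[OF assms(1)]]) simp
      have [measurable]: "(\<lambda>x. complementary \<Phi> (cmod (g x))) \<in> borel_measurable M"
        by (rule complementary_measurable) fact+
      show ?thesis
        by (simp add: nn_integral_cmult nn_integral_add modular_def)
    qed
    also have "\<dots> \<le> 2 * (1 + ?c)"
      using less_imp_le[OF k(2)] k(3) by (intro mult_mono add_right_mono) auto
    finally show "(\<integral>\<^sup>+x. ennreal (cmod (f x * g x)) \<partial>M) \<le> 2 * (1 + ?c)" .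
  qed
  also have "\<dots> < \<infinity>"
    using g(2) by (simp add: ennreal_mult_less_top)
  finally show ?thesis .
qed

lemma Hoelder_inequality_Orlicz:
  assumes "N_function \<Phi>" "f \<in> M_space M \<Phi>" "g \<in> borel_measurable M"
  assumes fin: "orlicz_norm M \<Phi> g < \<infinity>"
  shows "(\<integral>\<^sup>+x. ennreal (cmod (f x * g x)) \<partial>M) \<le> luxemburg_norm M \<Phi> f * orlicz_norm M \<Phi> g"
    (is "?I \<le> ?l * ?c")
proof -
  have f: "f \<in> borel_measurable M" using assms(2) by (simp add: M_space_def)
  have le: "?I \<le> ennreal k * ?c" if "0 < k" "modular M \<Phi> (\<lambda>x. f x / of_real k) \<le> 1" for k
    by (rule orlicz_norm_bound) fact+
  show ?thesis
  \<comment> \<open>Passing to the infimum over k means dividing by the Orlicz norm, so the value 0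
    is treated apart: there a single admissible k already makes the integral vanish.\<close>
  proof (cases "?c = 0")
    case True
    have "?l < \<infinity>" by (rule luxemburg_norm_finite) fact+
    then obtain k where "0 < k" "modular M \<Phi> (\<lambda>x. f x / of_real k) \<le> 1"
      by (auto simp: luxemburg_norm_def Inf_less_iff)
    from le[OF this] True show ?thesis by simp
  next
    case False
    have "?I / ?c \<le> ?l"
      unfolding luxemburg_norm_def
      by (rule Inf_greatest) (use le False in \<open>auto intro!: divide_le_posI_ennreal simp: zero_less_iff_neq_zero mult.commute\<close>)
    then have "?I / ?c * ?c \<le> ?l * ?c"
      by (rule mult_right_mono) simp
    moreover have "?I / ?c * ?c = ?I"
      using False fin by (simp add: ennreal_divide_times ennreal_divide_self)
    ultimately show ?thesis by simp
  qed
qed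

section \<open>Compact groups\<close>

locale compact_haar =
  fixes \<mu> :: "'a::{topological_group_add, t2_space} measure"
  assumes compact_UNIV: "compact (UNIV :: 'a set)"
    and haar: "haar_measure \<mu>"
begin

lemma sets_eq [measurable_cong]: "sets \<mu> = sets borel"
  using haar by (simp add: haar_measure_def)

lemma space_eq [simp]: "space \<mu> = UNIV"
  using sets_eq_imp_space_eq[OF sets_eq] by simp

lemma emeasure_compact: "compact K \<Longrightarrow> emeasure \<mu> K < \<infinity>"
  using haar by (simp add: haar_measure_def)

sublocale finite_measure \<mu>
  by (rule finite_measureI) (use emeasure_compact[OF compact_UNIV] in simp)

lemma measure_UNIV_pos: "0 < measure \<mu> UNIV"
  using haar by (simp add: haar_measure_def emeasure_eq_measure zero_less_measure_iff)

lemma continuous_translate: "continuous_on UNIV (\<lambda>y. x + y :: 'a)"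
  by (intro continuous_intros)

lemma continuous_measurable: "continuous_on UNIV f \<Longrightarrow> f \<in> borel_measurable \<mu>"
  using borel_measurable_continuous_onI[of f] by (simp add: measurable_cong_sets[OF sets_eq refl])

lemma measurable_translate: "(\<lambda>y. x + y) \<in> measurable \<mu> \<mu>"
  using borel_measurable_continuous_onI[OF continuous_translate]
  by (simp add: measurable_cong_sets[OF sets_eq sets_eq])

text \<open>Invariance is given for images of Borel sets. A preimage under a translation is an image
  under the inverse translation, which turns invariance into a change of variables for
  integrals.\<close>

lemma distr_translate: "distr \<mu> \<mu> (\<lambda>y. x + y) = \<mu>"
proof (rule measure_eqI)
  fix A assume "A \<in> sets (distr \<mu> \<mu> (\<lambda>y. x + y))"
  then have A: "A \<in> sets \<mu>" by simp
  have "(\<lambda>y. x + y) -` A = (\<lambda>y. - x + y) ` A"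
    by (auto simp: image_iff) (metis add.assoc left_minus add_0)
  moreover have "emeasure \<mu> ((\<lambda>y. - x + y) ` A) = emeasure \<mu> A"
    using haar A by (simp add: haar_measure_def sets_eq)
  ultimately show "emeasure (distr \<mu> \<mu> (\<lambda>y. x + y)) A = emeasure \<mu> A"
    by (simp add: emeasure_distr[OF measurable_translate A])
qed simp

lemma nn_integral_translate:
  assumes "f \<in> borel_measurable \<mu>"
  shows "(\<integral>\<^sup>+y. f (x + y) \<partial>\<mu>) = (\<integral>\<^sup>+y. f y \<partial>\<mu>)"
  using nn_integral_distr[OF measurable_translate, of f x] assms by (simp add: distr_translate)

lemma integral_translate:
  fixes f :: "'a \<Rightarrow> 'b::{banach, second_countable_topology}"
  assumes "f \<in> borel_measurable \<mu>"
  shows "(\<integral>y. f (x + y) \<partial>\<mu>) = (\<integral>y. f y \<partial>\<mu>)"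
  using integral_distr[OF measurable_translate assms, of x] by (simp add: distr_translate)

lemma continuous_bounded:
  fixes f :: "'a \<Rightarrow> 'b::real_normed_vector"
  assumes "continuous_on UNIV f"
  obtains c where "\<And>x. norm (f x) \<le> c"
proof -
  from compact_imp_bounded[OF compact_continuous_image[OF assms compact_UNIV]]
  obtain c where "\<forall>y\<in>range f. norm y \<le> c" by (auto simp: bounded_iff)
  then show thesis by (intro that[of c]) simp
qed

lemma continuous_integrable:
  fixes f :: "'a \<Rightarrow> 'b::{banach, second_countable_topology}"
  assumes "continuous_on UNIV f"
  shows "integrable \<mu> f"
proof -
  obtain c where "\<And>x. norm (f x) \<le> c" by (metis continuous_bounded[OF assms])
  then show ?thesis
    by (intro integrable_const_bound[of _ c] continuous_measurable assms) auto
qed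

text \<open>A function that is not integrable has Bochner integral 0, so the pointwise bound alone
  suffices.\<close>

lemma norm_integral_le_const:
  fixes f :: "'a \<Rightarrow> 'b::{banach, second_countable_topology}"
  assumes "\<And>x. norm (f x) \<le> c"
  shows "norm (\<integral>x. f x \<partial>\<mu>) \<le> c * measure \<mu> UNIV"
proof (cases "integrable \<mu> f")
  case True
  then have "(\<integral>x. norm (f x) \<partial>\<mu>) \<le> (\<integral>x. c \<partial>\<mu>)"
    using assms by (intro integral_mono) auto
  then have "norm (\<integral>x. f x \<partial>\<mu>) \<le> (\<integral>x. c \<partial>\<mu>)"
    using integral_norm_bound[of \<mu> f] by linarith
  then show ?thesis by (simp add: mult.commute)
next
  case False
  have "0 \<le> c" using assms[of undefined] norm_ge_zero order_trans by blast
  then show ?thesis using False by (simp add: not_integrable_integral_eq)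
qed

section \<open>Integrals depending on a parameter and interchange of integrals\<close>

lemma continuous_section:
  fixes F :: "'a \<times> 'a \<Rightarrow> 'b::topological_space"
  assumes "continuous_on UNIV F"
  shows "continuous_on UNIV (\<lambda>y. F (x, y))" "continuous_on UNIV (\<lambda>x. F (x, y))"
  by (intro continuous_on_compose2[OF assms] continuous_intros; simp)+

text \<open>Compactness of the second factor (tube lemma) makes continuity at x0 uniform in
  y.\<close>

lemma uniform_neighbourhood:
  fixes F :: "'a \<times> 'a \<Rightarrow> 'b::real_normed_vector"
  assumes "continuous_on UNIV F" "0 < e"
  obtains U where "x0 \<in> U" "open U" "\<And>x y. x \<in> U \<Longrightarrow> norm (F (x, y) - F (x0, y)) \<le> e"
proof -
  obtain U where "x0 \<in> U" "open U" "\<forall>x\<in>U \<inter> UNIV. \<forall>y\<in>UNIV. dist (F (x, y)) (F (x0, y)) \<le> e"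
    using continuous_on_prod_compactE[of UNIV UNIV F x0 e] compact_UNIV assms by auto
  then show thesis by (intro that[of U]) (auto simp: dist_norm)
qed

lemma continuous_parametric_integral:
  fixes F :: "'a \<times> 'a \<Rightarrow> 'b::{banach, second_countable_topology}"
  assumes F: "continuous_on UNIV F"
  shows "continuous_on UNIV (\<lambda>x. \<integral>y. F (x, y) \<partial>\<mu>)"
  unfolding continuous_on_def
proof (intro ballI tendstoI)
  fix x0 :: 'a and e :: real
  assume e: "0 < e"
  \<comment> \<open>Integrated over the group, d contributes e / 2, which leaves the final
    inequality strict.\<close>
  define d where "d = e / (2 * measure \<mu> UNIV)"
  have d: "0 < d" using e measure_UNIV_pos by (simp add: d_def)
  obtain U where U: "x0 \<in> U" "open U" "\<And>x y. x \<in> U \<Longrightarrow> norm (F (x, y) - F (x0, y)) \<le> d"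
    using uniform_neighbourhood[OF F d] by blast
  show "\<forall>\<^sub>F x in at x0 within UNIV. dist (\<integral>y. F (x, y) \<partial>\<mu>) (\<integral>y. F (x0, y) \<partial>\<mu>) < e"
  proof (rule eventually_at_topological[THEN iffD2], intro exI[of _ U] conjI U ballI impI)
    fix x assume "x \<in> U"
    have "norm ((\<integral>y. F (x, y) \<partial>\<mu>) - (\<integral>y. F (x0, y) \<partial>\<mu>)) = norm (\<integral>y. F (x, y) - F (x0, y) \<partial>\<mu>)"
      by (simp add: continuous_integrable continuous_section F)
    also have "\<dots> \<le> d * measure \<mu> UNIV"
      using U(3)[OF \<open>x \<in> U\<close>] by (rule norm_integral_le_const)
    also have "\<dots> < e" using e measure_UNIV_pos by (simp add: d_def)
    finally show "dist (\<integral>y. F (x, y) \<partial>\<mu>) (\<integral>y. F (x0, y) \<partial>\<mu>) < e"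
      by (simp add: dist_norm)
  qed
qed

text \<open>
  The Borel sets of \<open>'a \<times> 'a\<close> need not be generated by measurable rectangles, so the library's Fubini
  theorem is not applicable. Instead, \<open>F\<close> is approximated uniformly by finite sums
  \<open>\<Sum>i. indicator (B i) x * F (x i, y)\<close>.
\<close>

lemma Fubini_continuous:
  fixes F :: "'a \<times> 'a \<Rightarrow> complex"
  assumes F: "continuous_on UNIV F"
  shows "(\<integral>x. \<integral>y. F (x, y) \<partial>\<mu> \<partial>\<mu>) = (\<integral>y. \<integral>x. F (x, y) \<partial>\<mu> \<partial>\<mu>)"
proof -
  let ?m = "measure \<mu> UNIV"
  let ?I = "\<integral>x. \<integral>y. F (x, y) \<partial>\<mu> \<partial>\<mu>" and ?J = "\<integral>y. \<integral>x. F (x, y) \<partial>\<mu> \<partial>\<mu>"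
  have swap: "continuous_on UNIV (\<lambda>p. F (snd p, fst p))"
    by (intro continuous_on_compose2[OF F] continuous_intros) simp
  have int: "integrable \<mu> (\<lambda>y. F (x, y))" "integrable \<mu> (\<lambda>x. F (x, y))" for x y
    by (intro continuous_integrable continuous_section F)+
  have int2: "integrable \<mu> (\<lambda>x. \<integral>y. F (x, y) \<partial>\<mu>)" "integrable \<mu> (\<lambda>y. \<integral>x. F (x, y) \<partial>\<mu>)"
    using continuous_parametric_integral[OF F] continuous_parametric_integral[OF swap]
    by (auto intro: continuous_integrable)
  \<comment> \<open>Replacing F by the step function S below moves each iterated integral by at most
    \<open>e * ?m * ?m\<close>; the two errors give the factor 2.\<close>
  have bound: "cmod (?I - ?J) \<le> 2 * e * ?m * ?m" if e: "0 < e" for e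
  proof -
    have "\<exists>U. x0 \<in> U \<and> open U \<and> (\<forall>x\<in>U. \<forall>y. cmod (F (x, y) - F (x0, y)) \<le> e)" for x0
      using uniform_neighbourhood[OF F e, of x0] by metis
    then obtain U where U: "\<And>x. x \<in> U x" "\<And>x. open (U x)"
      "\<And>x0 x y. x \<in> U x0 \<Longrightarrow> cmod (F (x, y) - F (x0, y)) \<le> e" by metis
    have "UNIV \<subseteq> (\<Union>x\<in>UNIV. U x)" using U(1) by auto
    from compactE_image[OF compact_UNIV U(2) this]
    obtain C where C: "finite C" "UNIV \<subseteq> (\<Union>x\<in>C. U x)" by metis
    obtain p :: "nat \<Rightarrow> 'a" and n where p: "C = p ` {i. i < n}"
      using finite_imp_nat_seg_image_inj_on[OF C(1)] by metis
    \<comment> \<open>The finite cover is made disjoint, so that exactly one summand of S survives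
      at each x. The empty sets from index n on extend it to the infinite sequence on which
      \<open>disjointed\<close> operates.\<close>
    define B where "B = disjointed (\<lambda>i. if i < n then U (p i) else {})"
    have B_sub: "B i \<subseteq> U (p i)" if "i < n" for i
      using that disjointed_subset[of "\<lambda>i. if i < n then U (p i) else {}" i] by (simp add: B_def)
    have B_meas [measurable]: "B i \<in> sets \<mu>" for i
      unfolding B_def disjointed_def using U(2)
      by (intro sets.Diff sets.finite_UN) (auto simp: sets_eq)
    have B_ex: "\<exists>i<n. x \<in> B i" for x
    proof -
      have "x \<in> (\<Union>i. if i < n then U (p i) else {})"
        using C(2) by (force simp: p)
      then have "x \<in> (\<Union>i. B i)" by (simp add: B_def UN_disjointed_eq)
      then obtain i where "x \<in> B i" by auto
      moreover from this have "i < n"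
        using disjointed_subset[of "\<lambda>i. if i < n then U (p i) else {}" i]
        by (auto simp: B_def split: if_splits)
      ultimately show ?thesis by auto
    qed
    have B_disj: "disjoint_family B"
      unfolding B_def by (rule disjoint_family_disjointed)
    define S where "S = (\<lambda>x y. \<Sum>i<n. indicator (B i) x *\<^sub>R F (p i, y))"
    have S_eq: "S x y = F (p i, y)" if "i < n" "x \<in> B i" for x y i
    proof -
      have "indicator (B j) x *\<^sub>R F (p j, y) = (if j = i then F (p i, y) else 0)" for j
        using that(2) B_disj by (auto simp: indicator_def disjoint_family_on_def)
      then show ?thesis using that(1) by (simp only: S_def) simp
    qed
    have close: "cmod (F (x, y) - S x y) \<le> e" for x y
    proof -
      obtain i where i: "i < n" "x \<in> B i" using B_ex by blast
      then have "x \<in> U (p i)" using B_sub by blast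
      then show ?thesis using U(3) S_eq[OF i] by simp
    qed
    have indB: "integrable \<mu> (indicator (B i) :: 'a \<Rightarrow> real)" for i
      by (simp add: emeasure_eq_measure)
    have intS: "integrable \<mu> (\<lambda>y. S x y)" "integrable \<mu> (\<lambda>x. S x y)" for x y
      unfolding S_def
      by (intro Bochner_Integration.integrable_sum integrable_scaleR_left integrable_scaleR_right indB int)+
    have Sy: "(\<integral>y. S x y \<partial>\<mu>) = (\<Sum>i<n. indicator (B i) x *\<^sub>R (\<integral>y. F (p i, y) \<partial>\<mu>))" for x
      unfolding S_def by (subst Bochner_Integration.integral_sum)
        (intro integrable_scaleR_right int, simp)
    have Sx: "(\<integral>x. S x y \<partial>\<mu>) = (\<Sum>i<n. measure \<mu> (B i) *\<^sub>R F (p i, y))" for y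
      unfolding S_def by (subst Bochner_Integration.integral_sum)
        (intro integrable_scaleR_left indB, simp add: indB)
    have intSS: "integrable \<mu> (\<lambda>x. \<integral>y. S x y \<partial>\<mu>)" "integrable \<mu> (\<lambda>y. \<integral>x. S x y \<partial>\<mu>)"
      unfolding Sx Sy
      by (intro Bochner_Integration.integrable_sum integrable_scaleR_left integrable_scaleR_right indB int)+
    have "(\<integral>x. \<integral>y. S x y \<partial>\<mu> \<partial>\<mu>) = (\<Sum>i<n. measure \<mu> (B i) *\<^sub>R (\<integral>y. F (p i, y) \<partial>\<mu>))"
      unfolding Sy by (subst Bochner_Integration.integral_sum)
        (intro integrable_scaleR_left indB, simp add: indB)
    moreover have "(\<integral>y. \<integral>x. S x y \<partial>\<mu> \<partial>\<mu>) = (\<Sum>i<n. measure \<mu> (B i) *\<^sub>R (\<integral>y. F (p i, y) \<partial>\<mu>))"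
      unfolding Sx by (subst Bochner_Integration.integral_sum)
        (intro integrable_scaleR_right int, simp)
    ultimately have eq: "(\<integral>x. \<integral>y. S x y \<partial>\<mu> \<partial>\<mu>) = (\<integral>y. \<integral>x. S x y \<partial>\<mu> \<partial>\<mu>)" by simp
    have 1: "cmod (?I - (\<integral>x. \<integral>y. S x y \<partial>\<mu> \<partial>\<mu>)) \<le> e * ?m * ?m"
    proof -
      have "?I - (\<integral>x. \<integral>y. S x y \<partial>\<mu> \<partial>\<mu>) = (\<integral>x. (\<integral>y. F (x, y) - S x y \<partial>\<mu>) \<partial>\<mu>)"
        using int2 intSS by (simp add: int intS)
      then show ?thesis
        by (simp only:) (intro norm_integral_le_const close)
    qed
    have 2: "cmod (?J - (\<integral>y. \<integral>x. S x y \<partial>\<mu> \<partial>\<mu>)) \<le> e * ?m * ?m"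
    proof -
      have "?J - (\<integral>y. \<integral>x. S x y \<partial>\<mu> \<partial>\<mu>) = (\<integral>y. (\<integral>x. F (x, y) - S x y \<partial>\<mu>) \<partial>\<mu>)"
        using int2 intSS by (simp add: int intS)
      then show ?thesis
        by (simp only:) (intro norm_integral_le_const close)
    qed
    show ?thesis
      using norm_triangle_ineq4[of "?I - (\<integral>x. \<integral>y. S x y \<partial>\<mu> \<partial>\<mu>)" "?J - (\<integral>y. \<integral>x. S x y \<partial>\<mu> \<partial>\<mu>)"] 1 2 eq
      by simp
  qed
  have "cmod (?I - ?J) \<le> 0"
  proof (rule field_le_epsilon)
    fix e :: real
    assume "0 < e"
    then show "cmod (?I - ?J) \<le> 0 + e"
      using bound[of "e / (2 * ?m * ?m)"] measure_UNIV_pos by simp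
  qed
  then show ?thesis by simp
qed

section \<open>Convolution of continuous functions\<close>

lemma convolution_integrable:
  fixes f g :: "'a \<Rightarrow> complex"
  assumes "continuous_on UNIV f" "continuous_on UNIV g"
  shows "integrable \<mu> (\<lambda>y. f y * g (- y + x))"
  by (intro continuous_integrable continuous_intros assms continuous_on_compose2[OF assms(2)]) simp

lemma continuous_convolution:
  assumes "continuous_on UNIV f" "continuous_on UNIV g"
  shows "continuous_on UNIV (convolution \<mu> f g)"
proof -
  have "continuous_on UNIV (\<lambda>p. f (snd p) * g (- snd p + fst p))"
    by (intro continuous_intros continuous_on_compose2[OF assms(1)] continuous_on_compose2[OF assms(2)])
       simp_all
  from continuous_parametric_integral[OF this] show ?thesis
    by (simp add: convolution_def)
qed

text \<open>The two integrals are interchanged, and left invariance then permits replacing y by z +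
  y in the inner one.\<close>

lemma convolution_assoc:
  assumes f: "continuous_on UNIV f" and g: "continuous_on UNIV g" and h: "continuous_on UNIV h"
  shows "convolution \<mu> (convolution \<mu> f g) h = convolution \<mu> f (convolution \<mu> g h)"
proof
  fix x
  let ?F = "\<lambda>p. f (snd p) * g (- snd p + fst p) * h (- fst p + x)"
  have F: "continuous_on UNIV ?F"
    by (intro continuous_intros continuous_on_compose2[OF f] continuous_on_compose2[OF g]
        continuous_on_compose2[OF h]) simp_all
  have "convolution \<mu> (convolution \<mu> f g) h x = (\<integral>y. \<integral>z. ?F (y, z) \<partial>\<mu> \<partial>\<mu>)"
    using convolution_integrable[OF f g] by (simp add: convolution_def)
  also have "\<dots> = (\<integral>z. \<integral>y. ?F (y, z) \<partial>\<mu> \<partial>\<mu>)"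
    by (rule Fubini_continuous) fact
  also have "\<dots> = (\<integral>z. \<integral>y. ?F (z + y, z) \<partial>\<mu> \<partial>\<mu>)"
    by (intro Bochner_Integration.integral_cong refl integral_translate[symmetric]
        continuous_measurable continuous_section(2)[OF F])
  also have "\<dots> = (\<integral>z. f z * (\<integral>y. g y * h (- y + (- z + x)) \<partial>\<mu>) \<partial>\<mu>)"
    using convolution_integrable[OF g h]
    by (simp add: minus_add mult.assoc flip: add.assoc)
  also have "\<dots> = convolution \<mu> f (convolution \<mu> g h) x"
    by (simp add: convolution_def)
  finally show "convolution \<mu> (convolution \<mu> f g) h x = convolution \<mu> f (convolution \<mu> g h) x" .
qed

lemma convolution_add:
  assumes "continuous_on UNIV f" "continuous_on UNIV g" "continuous_on UNIV h"
  shows "convolution \<mu> (\<lambda>x. f x + g x) h = (\<lambda>x. convolution \<mu> f h x + convolution \<mu> g h x)"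
    "convolution \<mu> f (\<lambda>x. g x + h x) = (\<lambda>x. convolution \<mu> f g x + convolution \<mu> f h x)"
  using convolution_integrable[OF assms(1,2)] convolution_integrable[OF assms(1,3)]
    convolution_integrable[OF assms(2,3)]
  by (simp_all add: convolution_def distrib_left distrib_right)

lemma convolution_scale:
  "convolution \<mu> (\<lambda>x. c * f x) g = (\<lambda>x. c * convolution \<mu> f g x)"
  "convolution \<mu> f (\<lambda>x. c * g x) = (\<lambda>x. c * convolution \<mu> f g x)"
  by (simp_all add: convolution_def mult.assoc mult.left_commute[of _ c])

lemma norm_convolution_le:
  assumes "continuous_on UNIV f" "\<And>x. cmod (g x) \<le> c"
  shows "cmod (convolution \<mu> f g x) \<le> c * (\<integral>y. cmod (f y) \<partial>\<mu>)"
proof -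
  have c: "0 \<le> c" using assms(2)[of undefined] norm_ge_zero order_trans by blast
  have f: "integrable \<mu> (\<lambda>y. cmod (f y))"
    by (intro continuous_integrable continuous_intros assms)
  have "cmod (convolution \<mu> f g x) \<le> (\<integral>y. cmod (f y * g (- y + x)) \<partial>\<mu>)"
    unfolding convolution_def by (rule integral_norm_bound)
  also have "\<dots> \<le> (\<integral>y. cmod (f y) * c \<partial>\<mu>)"
    by (rule integral_mono') (use assms f c in \<open>auto simp: norm_mult intro!: mult_left_mono\<close>)
  finally show ?thesis by (simp add: mult.commute)
qed

section \<open>Small neighbourhoods, bump functions and a criterion for finiteness\<close>

lemma closed_imp_compact: "closed (S :: 'a set) \<Longrightarrow> compact S"
  using compact_Int_closed[OF compact_UNIV] by simp

lemma emeasure_image_translate: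
  "B \<in> sets borel \<Longrightarrow> emeasure \<mu> ((\<lambda>y. x + y) ` B) = emeasure \<mu> B"
  using haar by (simp add: haar_measure_def)

lemma open_translate:
  assumes "open (V :: 'a set)"
  shows "open ((\<lambda>y. x + y) ` V)"
proof -
  have "(\<lambda>y. x + y) ` V = (\<lambda>y. - x + y) -` V"
    by (auto simp: image_iff) (metis add.assoc right_minus add_0)
  then show ?thesis
    using open_vimage[OF assms continuous_translate] by simp
qed

text \<open>If V were a null set, so would be its translates. Finitely many of them cover the
  compact group, whose measure would then be 0.\<close>

lemma measure_open_pos:
  assumes "open V" "V \<noteq> {}"
  shows "0 < measure \<mu> V"
proof (rule ccontr)
  assume "\<not> 0 < measure \<mu> V"
  then have "emeasure \<mu> V = 0"
    using measure_nonneg[of \<mu> V] by (simp add: emeasure_eq_measure)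
  then have null: "(\<lambda>y. x + y) ` V \<in> null_sets \<mu>" for x
    using assms(1) open_translate[OF assms(1), of x]
    by (auto simp: null_sets_def sets_eq emeasure_image_translate)
  obtain v where "v \<in> V" using assms(2) by auto
  have "x \<in> (\<lambda>y. (x - v) + y) ` V" for x
    using \<open>v \<in> V\<close> by (rule rev_image_eqI) simp
  then have "UNIV \<subseteq> (\<Union>x\<in>UNIV. (\<lambda>y. x + y) ` V)" by blast
  from compactE_image[OF compact_UNIV open_translate[OF assms(1)] this]
  obtain C where C: "finite C" "UNIV \<subseteq> (\<Union>x\<in>C. (\<lambda>y. x + y) ` V)" by metis
  have "(\<Union>x\<in>C. (\<lambda>y. x + y) ` V) \<in> null_sets \<mu>"
    using C(1) null by (intro null_sets_UN') (auto intro: countable_finite)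
  with C(2) have "UNIV \<in> null_sets \<mu>"
    by (simp add: top.extremum_unique)
  then show False
    using measure_UNIV_pos by (auto simp: null_sets_def emeasure_eq_measure)
qed

lemma normal_space_euclidean: "normal_space (euclidean :: 'a topology)"
proof (rule compact_Hausdorff_or_regular_imp_normal_space)
  show "compact_space (euclidean :: 'a topology)"
    using compact_UNIV by (simp add: compact_space_def)
  show "Hausdorff_space (euclidean :: 'a topology) \<or> regular_space (euclidean :: 'a topology)"
    unfolding Hausdorff_space_def disjnt_def by (metis hausdorff open_openin)
qed

text \<open>Urysohn's lemma separates 0 from the complement of V. Multiplying by the reflected
  function creates symmetry, and keeps the value 1 at 0 and the zeros off V.\<close>

lemma symmetric_bump_function:
  assumes "open V" "0 \<in> V"
  obtains \<phi> :: "'a \<Rightarrow> real" where "continuous_on UNIV \<phi>" "\<And>x. 0 \<le> \<phi> x" "\<And>x. \<phi> (- x) = \<phi> x"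
    "\<phi> 0 = 1" "\<And>x. x \<notin> V \<Longrightarrow> \<phi> x = 0"
proof -
  have "closedin euclidean (- V)" "closedin euclidean {0::'a}" "disjnt (- V) {0}" "(0::real) \<le> 1"
    using assms by (auto simp: disjnt_def closed_Compl simp flip: closed_closedin)
  from Urysohn_lemma[OF normal_space_euclidean this]
  obtain f :: "'a \<Rightarrow> real" where f: "continuous_map euclidean (top_of_set {0..1}) f"
    "f ` (- V) \<subseteq> {0}" "f ` {0} \<subseteq> {1}" .
  have cont: "continuous_on UNIV f" and range: "f x \<in> {0..1}" for x
    using f(1) by (auto simp: continuous_map_in_subtopology)
  show thesis
  proof (rule that[of "\<lambda>x. f x * f (- x)"])
    show "continuous_on UNIV (\<lambda>x. f x * f (- x))"
      by (intro continuous_intros cont continuous_on_compose2[OF cont]) simp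
  qed (use f(2,3) range in \<open>auto simp: mult.commute\<close>)
qed

text \<open>Cauchy-Schwarz for \<open>\<phi>\<close> and the indicator of V, read off from the
  integral of the square of their difference after scaling the indicator by c.\<close>

lemma square_integral_le:
  fixes \<phi> :: "'a \<Rightarrow> real"
  assumes \<phi>: "continuous_on UNIV \<phi>" "\<And>x. x \<notin> V \<Longrightarrow> \<phi> x = 0" and V: "open V" "V \<noteq> {}"
  shows "(\<integral>x. \<phi> x \<partial>\<mu>)\<^sup>2 \<le> (\<integral>x. (\<phi> x)\<^sup>2 \<partial>\<mu>) * measure \<mu> V"
proof -
  let ?m = "measure \<mu> V" and ?s = "\<integral>x. (\<phi> x)\<^sup>2 \<partial>\<mu>" and ?t = "\<integral>x. \<phi> x \<partial>\<mu>"
  have m: "0 < ?m" by (rule measure_open_pos[OF V])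
  \<comment> \<open>The mean of \<open>\<phi>\<close> over V, which is the value of c that minimises
    the integral below.\<close>
  define c where "c = ?t / ?m"
  have [simp]: "integrable \<mu> \<phi>" "integrable \<mu> (\<lambda>x. (\<phi> x)\<^sup>2)"
    by (intro continuous_integrable continuous_intros \<phi>)+
  have [simp]: "integrable \<mu> (indicator V :: 'a \<Rightarrow> real)"
    using V(1) by (simp add: sets_eq emeasure_eq_measure)
  have "0 \<le> (\<integral>x. (\<phi> x - c * indicator V x)\<^sup>2 \<partial>\<mu>)" by simp
  also have "\<dots> = (\<integral>x. (\<phi> x)\<^sup>2 - 2 * c * \<phi> x + c\<^sup>2 * indicator V x \<partial>\<mu>)"
    using \<phi>(2) by (intro Bochner_Integration.integral_cong)
      (auto simp: indicator_def power2_diff algebra_simps)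
  also have "\<dots> = ?s - 2 * c * ?t + c\<^sup>2 * ?m"
    using V(1) by (simp add: sets_eq)
  also have "\<dots> = ?s - ?t\<^sup>2 / ?m"
    using m by (simp add: c_def power2_eq_square field_simps)
  finally show ?thesis using m by (simp add: field_simps)
qed

lemma measure_singleton: "measure \<mu> {x} = measure \<mu> {0}"
  using emeasure_image_translate[of "{0}" x] by (simp add: emeasure_eq_measure)

text \<open>Left invariance gives all points the same mass, and the total mass is finite.\<close>

lemma finite_if_singleton_pos:
  assumes "0 < measure \<mu> {0}"
  shows "finite (UNIV :: 'a set)"
proof (rule ccontr)
  assume inf: "infinite (UNIV :: 'a set)"
  obtain n where n: "measure \<mu> UNIV < real n * measure \<mu> {0}"
    using ex_less_of_nat_mult[OF assms] by blast
  obtain S :: "'a set" where S: "finite S" "card S = n"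
    using infinite_arbitrarily_large[OF inf] by metis
  have "measure \<mu> S = (\<Sum>x\<in>S. measure \<mu> {x})"
    using S(1) by (intro finite_measure_eq_sum_singleton) (auto simp: sets_eq)
  also have "\<dots> = real n * measure \<mu> {0}"
    using S(2) by (subst sum.cong[OF refl measure_singleton]) simp
  finally show False
    using n bounded_measure[of S] by simp
qed

text \<open>
  By Cauchy-Schwarz, functions supported in a neighbourhood of \<open>0\<close> of measure less than \<open>1 / K\<close>
  violate the inequality.
\<close>

lemma finite_if_L2_le_L1:
  assumes K: "\<And>\<phi> :: 'a \<Rightarrow> real. continuous_on UNIV \<phi> \<Longrightarrow> (\<And>x. 0 \<le> \<phi> x) \<Longrightarrow> (\<And>x. \<phi> (- x) = \<phi> x) \<Longrightarrow>
      (\<integral>x. (\<phi> x)\<^sup>2 \<partial>\<mu>) \<le> K * (\<integral>x. \<phi> x \<partial>\<mu>)\<^sup>2"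
  shows "finite (UNIV :: 'a set)"
proof -
  \<comment> \<open>K may be negative or zero; the larger constant L is positive and can be
    inverted.\<close>
  define L where "L = max K 1"
  have L: "0 < L" "K \<le> L" by (auto simp: L_def)
  have "1 / L \<le> measure \<mu> V" if V: "open V" "0 \<in> V" for V
  proof -
    obtain \<phi> :: "'a \<Rightarrow> real" where \<phi>: "continuous_on UNIV \<phi>" "\<And>x. 0 \<le> \<phi> x" "\<And>x. \<phi> (- x) = \<phi> x"
      "\<phi> 0 = 1" "\<And>x. x \<notin> V \<Longrightarrow> \<phi> x = 0"
      using symmetric_bump_function[OF V] by metis
    let ?s = "\<integral>x. (\<phi> x)\<^sup>2 \<partial>\<mu>" and ?t = "\<integral>x. \<phi> x \<partial>\<mu>"
    \<comment> \<open>A nonempty open set on which the square of \<open>\<phi>\<close> exceeds 1/4.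
      Its positive measure makes the integral of the square positive, so that this integral can be
      cancelled below.\<close>
    define W where "W = \<phi> -` {1/2<..}"
    have "0 \<in> W" by (simp add: W_def \<phi>(4))
    then have W: "open W" "W \<noteq> {}"
      using open_vimage[OF open_greaterThan \<phi>(1), of "1/2"] by (auto simp: W_def)
    have "(\<integral>x. 1/4 * indicator W x \<partial>\<mu>) \<le> ?s"
    proof (rule integral_mono)
      show "integrable \<mu> (\<lambda>x. 1/4 * indicator W x :: real)"
        using W(1) by (simp add: sets_eq emeasure_eq_measure)
      show "integrable \<mu> (\<lambda>x. (\<phi> x)\<^sup>2)"
        by (intro continuous_integrable continuous_intros \<phi>)
      show "1/4 * indicator W x \<le> (\<phi> x)\<^sup>2" for x
        using power_mono[of "1/2" "\<phi> x" 2] by (auto simp: W_def indicator_def power2_eq_square)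
    qed
    then have s: "0 < ?s"
      using measure_open_pos[OF W] W(1) by (simp add: sets_eq)
    have "?s \<le> K * ?t\<^sup>2" using K \<phi> by blast
    also have "\<dots> \<le> L * ?t\<^sup>2" using L by (intro mult_right_mono) auto
    also have "\<dots> \<le> L * (?s * measure \<mu> V)"
      using square_integral_le[OF \<phi>(1,5) V(1)] V(2) L by (intro mult_left_mono) auto
    finally have "?s * 1 \<le> ?s * (L * measure \<mu> V)" by (simp add: ac_simps)
    then have "1 \<le> L * measure \<mu> V" using s by (simp only: mult_le_cancel_left_pos)
    then show ?thesis using L by (simp add: divide_le_eq mult.commute)
  qed
  note nbhd = this
  \<comment> \<open>Outer regularity carries the lower bound from the neighbourhoods of 0 to the
    point itself.\<close>
  have "emeasure \<mu> {0} = (INF V\<in>{V. open V \<and> {0} \<subseteq> V}. emeasure \<mu> V)"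
    using haar unfolding haar_measure_def by (elim conjE) (erule bspec, simp)
  moreover have "ennreal (1 / L) \<le> (INF V\<in>{V. open V \<and> {0} \<subseteq> V}. emeasure \<mu> V)"
    using nbhd by (intro INF_greatest) (auto simp: emeasure_eq_measure intro: ennreal_leI)
  ultimately have "ennreal (1 / L) \<le> emeasure \<mu> {0}" by simp
  then have "1 / L \<le> measure \<mu> {0}"
    by (simp add: emeasure_eq_measure)
  moreover have "0 < 1 / L" using L by simp
  ultimately have "0 < measure \<mu> {0}" by linarith
  then show ?thesis by (rule finite_if_singleton_pos)
qed

text \<open>As a function of y, g(-y + x) involves an inversion, to which left invariance does not
  apply. For symmetric g it equals g(-x + y), a left translate of g with the same L1 norm.\<close>

lemma norm_convolution_symmetric_le:
  assumes f: "\<And>x. cmod (f x) \<le> c" and g: "continuous_on UNIV g" "\<And>x. g (- x) = g x"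
  shows "cmod (convolution \<mu> f g x) \<le> c * (\<integral>y. cmod (g y) \<partial>\<mu>)"
proof -
  have c: "0 \<le> c" using f[of undefined] norm_ge_zero order_trans by blast
  have eq: "g (- y + x) = g (- x + y)" for y
    using g(2)[of "- x + y"] by (simp add: minus_add)
  have g': "continuous_on UNIV (\<lambda>y. cmod (g y))" by (intro continuous_intros g)
  have int: "integrable \<mu> (\<lambda>y. cmod (g (- x + y)))"
    by (intro continuous_integrable continuous_intros continuous_on_compose2[OF g']) simp
  have "cmod (convolution \<mu> f g x) \<le> (\<integral>y. cmod (f y * g (- x + y)) \<partial>\<mu>)"
    unfolding convolution_def eq by (rule integral_norm_bound)
  also have "\<dots> \<le> (\<integral>y. c * cmod (g (- x + y)) \<partial>\<mu>)"
    by (rule integral_mono') (use int f c in \<open>auto simp: norm_mult intro!: mult_right_mono\<close>)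
  also have "\<dots> = c * (\<integral>y. cmod (g y) \<partial>\<mu>)"
    using integral_translate[OF continuous_measurable[OF g'], of "- x"] by simp
  finally show ?thesis .
qed

lemma continuous_in_C_0: "u \<in> C_0 \<longleftrightarrow> continuous_on UNIV u" for u :: "'a \<Rightarrow> complex"
proof
  assume u: "continuous_on UNIV u"
  have "compact {x. \<epsilon> \<le> cmod (u x)}" for \<epsilon>
    by (intro closed_imp_compact closed_Collect_le continuous_intros u)
  with u show "u \<in> C_0" by (simp add: C_0_def)
qed (simp add: C_0_def)

lemma inv_reflect_inv_reflect [simp]: "inv_reflect (inv_reflect g) = (g :: 'a \<Rightarrow> complex)"
  by (simp add: inv_reflect_def)

lemma continuous_inv_reflect: "continuous_on UNIV g \<Longrightarrow> continuous_on UNIV (inv_reflect g :: 'a \<Rightarrow> complex)"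
  unfolding inv_reflect_def by (rule continuous_on_compose2[of UNIV g]) (auto intro!: continuous_intros)

end

section \<open>The algebra \<open>A_Phi\<close> of a compact group\<close>

locale compact_orlicz = compact_haar +
  fixes \<Phi> :: "real \<Rightarrow> real"
  assumes N: "N_function \<Phi>"
begin

abbreviation "A \<equiv> A_Phi \<mu> \<Phi>"

section \<open>Translation invariance and comparison with the supremum norm\<close>

lemma continuous_in_M_space:
  assumes "continuous_on UNIV f"
  shows "f \<in> M_space \<mu> \<Phi>" "f \<in> M_space \<mu> (complementary \<Phi>)"
proof -
  obtain c where c: "\<And>x. cmod (f x) \<le> c" by (metis continuous_bounded[OF assms])
  show "f \<in> M_space \<mu> \<Phi>" "f \<in> M_space \<mu> (complementary \<Phi>)"
    by (rule bounded_in_M_space[OF _ continuous_measurable[OF assms] c];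
        simp add: finite_measure_axioms N_function_mono[OF N] complementary_mono[OF N])+
qed

lemma M_space_measurable: "f \<in> M_space \<mu> P \<Longrightarrow> f \<in> borel_measurable \<mu>"
  by (simp add: M_space_def)

lemma modular_translate:
  assumes "f \<in> borel_measurable \<mu>"
  shows "modular \<mu> \<Phi> (\<lambda>y. f (x + y)) = modular \<mu> \<Phi> f"
proof -
  have "(\<lambda>y. ennreal (\<Phi> (cmod (f y)))) \<in> borel_measurable \<mu>"
    using measurable_compose[OF _ N_function_measurable[OF N], of "\<lambda>y. cmod (f y)" \<mu>] assms by simp
  from nn_integral_translate[OF this] show ?thesis by (simp add: modular_def)
qed

lemma M_space_translate:
  assumes "f \<in> M_space \<mu> \<Phi>"
  shows "(\<lambda>y. f (x + y)) \<in> M_space \<mu> \<Phi>"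
proof -
  have f: "f \<in> borel_measurable \<mu>" using assms by (rule M_space_measurable)
  then have "modular \<mu> \<Phi> (\<lambda>y. of_real a * f (x + y)) = modular \<mu> \<Phi> (\<lambda>y. of_real a * f y)" for a
    by (intro modular_translate) simp
  then show ?thesis
    using assms measurable_compose[OF measurable_translate f] by (simp add: M_space_def)
qed

lemma luxemburg_norm_translate:
  assumes "f \<in> borel_measurable \<mu>"
  shows "luxemburg_norm \<mu> \<Phi> (\<lambda>y. f (x + y)) = luxemburg_norm \<mu> \<Phi> f"
  using assms modular_translate[of "\<lambda>y. f y / of_real k" x for k]
  by (simp add: luxemburg_norm_def)

text \<open>Substituting x + y for y moves the translation from g to f, whose Luxemburg norm is
  translation invariant; then Hoelder's inequality applies.\<close>

lemma norm_convolution_le_cost: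
  assumes f: "f \<in> M_space \<mu> \<Phi>" and g: "g \<in> M_space \<mu> (complementary \<Phi>)"
  shows "ennreal (cmod (convolution \<mu> f (inv_reflect g) x)) \<le> luxemburg_norm \<mu> \<Phi> f * orlicz_norm \<mu> \<Phi> g"
proof -
  let ?h = "\<lambda>y. f y * g (- x + y)"
  note [measurable] = M_space_measurable[OF f] M_space_measurable[OF g]
    measurable_compose[OF measurable_translate M_space_measurable[OF g]]
  have "convolution \<mu> f (inv_reflect g) x = integral\<^sup>L \<mu> ?h"
    by (simp add: convolution_def inv_reflect_def minus_add)
  moreover have "ennreal (cmod (integral\<^sup>L \<mu> ?h)) \<le> (\<integral>\<^sup>+y. ennreal (cmod (?h y)) \<partial>\<mu>)"
    by (cases "integrable \<mu> ?h")
       (simp_all only: integral_norm_bound_ennreal, simp add: not_integrable_integral_eq)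
  moreover have "(\<integral>\<^sup>+y. ennreal (cmod (?h y)) \<partial>\<mu>) = (\<integral>\<^sup>+y. ennreal (cmod (f (x + y) * g y)) \<partial>\<mu>)"
    by (subst nn_integral_translate[of _ x, symmetric]) simp_all
  moreover have "\<dots> \<le> luxemburg_norm \<mu> \<Phi> (\<lambda>y. f (x + y)) * orlicz_norm \<mu> \<Phi> g"
    by (intro Hoelder_inequality_Orlicz N M_space_translate f M_space_measurable[OF g]
        orlicz_norm_finite g)
  ultimately show ?thesis
    by (simp add: luxemburg_norm_translate M_space_measurable[OF f])
qed

text \<open>The termwise estimates are summed in \<open>ennreal\<close>. Finiteness of the cost
  gives absolute convergence, so the modulus may be taken inside the series.\<close>

lemma norm_le_rep_cost:
  assumes "represents \<mu> \<Phi> f g u"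
  shows "ennreal (cmod (u x)) \<le> rep_cost \<mu> \<Phi> f g"
proof -
  let ?a = "\<lambda>n. convolution \<mu> (f n) (inv_reflect (g n)) x"
  have a: "?a sums u x" and fin: "rep_cost \<mu> \<Phi> f g < \<infinity>"
    using assms by (auto simp: represents_def)
  have le: "(\<Sum>n. ennreal (cmod (?a n))) \<le> rep_cost \<mu> \<Phi> f g"
    unfolding rep_cost_def using assms
    by (intro suminf_le norm_convolution_le_cost) (auto simp: represents_def)
  then have sum: "summable (\<lambda>n. cmod (?a n))"
    using fin by (intro summable_suminf_not_top) (auto simp: top_unique)
  have "cmod (u x) \<le> (\<Sum>n. cmod (?a n))"
    using summable_norm[OF sum] sums_unique[OF a] by simp
  then have "ennreal (cmod (u x)) \<le> (\<Sum>n. ennreal (cmod (?a n)))"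
    by (subst suminf_ennreal2[OF _ sum]) (auto intro: ennreal_leI)
  with le show ?thesis by (rule order_trans[rotated])
qed

lemma carrier_A: "u \<in> carrier A \<longleftrightarrow> continuous_on UNIV u \<and> (\<exists>f g. represents \<mu> \<Phi> f g u)"
  by (simp add: A_Phi_def continuous_in_C_0)

lemma norm_le_vnorm:
  assumes "u \<in> carrier A"
  shows "cmod (u x) \<le> vnorm A u"
proof -
  let ?S = "{rep_cost \<mu> \<Phi> f g |f g. represents \<mu> \<Phi> f g u}"
  obtain f g where fg: "represents \<mu> \<Phi> f g u" using assms by (auto simp: carrier_A)
  have "Inf ?S \<le> rep_cost \<mu> \<Phi> f g" by (rule Inf_lower) (use fg in auto)
  also have "\<dots> < \<infinity>" using fg by (simp add: represents_def)
  \<comment> \<open>Finiteness matters because \<open>enn2real\<close> sends infinity to 0 and is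
    therefore monotone only below infinity.\<close>
  finally have fin: "Inf ?S < \<infinity>" .
  have "ennreal (cmod (u x)) \<le> Inf ?S"
    by (rule Inf_greatest) (auto intro: norm_le_rep_cost)
  then have "enn2real (ennreal (cmod (u x))) \<le> enn2real (Inf ?S)"
    using fin by (intro enn2real_mono) simp_all
  then show ?thesis by (simp add: A_Phi_def)
qed

section \<open>Elements and differences in the algebra, and approximate identities\<close>

lemma orlicz_norm_zero: "orlicz_norm \<mu> \<Phi> (\<lambda>x. 0) = 0"
proof -
  have "orlicz_norm \<mu> \<Phi> (\<lambda>x. 0) \<le> 0"
    unfolding orlicz_norm_def by (rule SUP_least) simp
  then show ?thesis by simp
qed

text \<open>A series with one nonzero term. Only g is cut off after index 0; the Orlicz norm of 0 is
  0, so the constant sequence f adds no further cost.\<close>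

lemma represents_convolution:
  assumes f: "continuous_on UNIV f" and g: "continuous_on UNIV g"
  shows "represents \<mu> \<Phi> (\<lambda>n. f) (\<lambda>n. if n = 0 then inv_reflect g else (\<lambda>x. 0)) (convolution \<mu> f g)"
    and "rep_cost \<mu> \<Phi> (\<lambda>n. f) (\<lambda>n. if n = 0 then inv_reflect g else (\<lambda>x. 0))
      = luxemburg_norm \<mu> \<Phi> f * orlicz_norm \<mu> \<Phi> (inv_reflect g)"
proof -
  let ?g = "\<lambda>n::nat. if n = 0 then inv_reflect g else (\<lambda>x. 0)"
  have "(\<Sum>n. luxemburg_norm \<mu> \<Phi> f * orlicz_norm \<mu> \<Phi> (?g n))
      = (\<Sum>n\<in>{0}. luxemburg_norm \<mu> \<Phi> f * orlicz_norm \<mu> \<Phi> (?g n))"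
    by (rule suminf_finite) (auto simp: orlicz_norm_zero)
  then show cost: "rep_cost \<mu> \<Phi> (\<lambda>n. f) ?g = luxemburg_norm \<mu> \<Phi> f * orlicz_norm \<mu> \<Phi> (inv_reflect g)"
    by (simp add: rep_cost_def)
  have g': "inv_reflect g \<in> M_space \<mu> (complementary \<Phi>)"
    by (intro continuous_in_M_space continuous_inv_reflect g)
  have "convolution \<mu> f (inv_reflect (?g n)) x = (if n = 0 then convolution \<mu> f g x else 0)" for n x
    by (auto simp: convolution_def inv_reflect_def)
  then have "(\<lambda>n. convolution \<mu> f (inv_reflect (?g n)) x) sums convolution \<mu> f g x" for x
    using sums_single[of 0 "\<lambda>n. convolution \<mu> f g x"] by simp
  then show "represents \<mu> \<Phi> (\<lambda>n. f) ?g (convolution \<mu> f g)"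
    using continuous_in_M_space[OF f] g' continuous_in_M_space(2)[of "\<lambda>x. 0"]
      luxemburg_norm_finite[OF N, of f \<mu>] orlicz_norm_finite[OF N g']
    by (simp add: represents_def cost ennreal_mult_less_top)
qed

lemma convolution_in_A:
  assumes "continuous_on UNIV f" "continuous_on UNIV g"
  shows "convolution \<mu> f g \<in> carrier A"
  using represents_convolution(1)[OF assms] continuous_convolution[OF assms]
  by (auto simp: carrier_A)

lemma vnorm_zero: "vnorm A (\<lambda>x. 0) = 0"
proof -
  have "represents \<mu> \<Phi> (\<lambda>n. \<lambda>x. 0) (\<lambda>n. if n = 0 then inv_reflect (\<lambda>x. 0) else (\<lambda>x. 0)) (\<lambda>x. 0)"
    and "rep_cost \<mu> \<Phi> (\<lambda>n. \<lambda>x. 0) (\<lambda>n. if n = 0 then inv_reflect (\<lambda>x. 0) else (\<lambda>x. 0)) = 0"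
    using represents_convolution[of "\<lambda>x. 0" "\<lambda>x. 0"]
    by (simp_all add: convolution_def inv_reflect_def orlicz_norm_zero)
  then have "Inf {rep_cost \<mu> \<Phi> f g |f g. represents \<mu> \<Phi> f g (\<lambda>x. 0)} \<le> 0"
    by (intro Inf_lower CollectI exI conjI) (rule sym)
  then show ?thesis by (simp add: A_Phi_def)
qed

text \<open>Negating the first factors of a representation preserves their Luxemburg norms. The
  membership is used in \<open>minus_A\<close> to evaluate the additive inverse.\<close>

lemma uminus_in_A:
  assumes "u \<in> carrier A"
  shows "(\<lambda>x. - u x) \<in> carrier A"
proof -
  obtain f g where fg: "represents \<mu> \<Phi> f g u" and u: "continuous_on UNIV u"
    using assms by (auto simp: carrier_A)
  have [simp]: "luxemburg_norm \<mu> \<Phi> (\<lambda>x. - f n x) = luxemburg_norm \<mu> \<Phi> (f n)" for n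
    by (simp add: luxemburg_norm_def modular_def norm_divide)
  have "(\<lambda>n. convolution \<mu> (\<lambda>x. - f n x) (inv_reflect (g n)) x) sums - u x" for x
    using sums_minus[of "\<lambda>n. convolution \<mu> (f n) (inv_reflect (g n)) x" "u x"] fg
    by (simp add: represents_def convolution_def)
  then have "represents \<mu> \<Phi> (\<lambda>n x. - f n x) g (\<lambda>x. - u x)"
    using fg by (simp add: represents_def rep_cost_def M_space_def modular_def)
  then show ?thesis using u by (auto simp: carrier_A intro!: continuous_intros)
qed

text \<open>\<open>a_inv\<close> is a definite description over the carrier; existence of the
  negative in \<open>carrier A\<close> and its uniqueness identify it with the pointwise
  negative.\<close>

lemma minus_A:
  assumes "v \<in> carrier A"
  shows "u \<ominus>\<^bsub>A\<^esub> v = (\<lambda>x. u x - v x)"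
proof -
  have "\<ominus>\<^bsub>A\<^esub> v = (\<lambda>x. - v x)"
    unfolding a_inv_def m_inv_def
  proof (rule the_equality)
    show "(\<lambda>x. - v x) \<in> carrier (add_monoid A) \<and> v \<otimes>\<^bsub>add_monoid A\<^esub> (\<lambda>x. - v x) = \<one>\<^bsub>add_monoid A\<^esub>
        \<and> (\<lambda>x. - v x) \<otimes>\<^bsub>add_monoid A\<^esub> v = \<one>\<^bsub>add_monoid A\<^esub>"
      using uminus_in_A[OF assms] by (simp add: A_Phi_def)
  next
    fix w
    assume "w \<in> carrier (add_monoid A) \<and> v \<otimes>\<^bsub>add_monoid A\<^esub> w = \<one>\<^bsub>add_monoid A\<^esub>
        \<and> w \<otimes>\<^bsub>add_monoid A\<^esub> v = \<one>\<^bsub>add_monoid A\<^esub>"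
    then have "(\<lambda>x. w x + v x) = (\<lambda>x. 0)" by (simp add: A_Phi_def)
    then show "w = (\<lambda>x. - v x)"
      by (metis (no_types) eq_neg_iff_add_eq_0)
  qed
  then show ?thesis by (simp add: a_minus_def A_Phi_def)
qed

lemma A_simps:
  "\<zero>\<^bsub>A\<^esub> = (\<lambda>x. 0)" "u \<oplus>\<^bsub>A\<^esub> v = (\<lambda>x. u x + v x)" "u \<otimes>\<^bsub>A\<^esub> v = convolution \<mu> u v"
  "c \<odot>\<^bsub>A\<^esub> u = (\<lambda>x. c * u x)"
  by (simp_all add: A_Phi_def)

lemma unital_imp_bounded_approximate_identity:
  assumes "unital A"
  shows "has_bounded_approximate_identity A"
proof -
  obtain e where e: "e \<in> carrier A" "\<And>a. a \<in> carrier A \<Longrightarrow> e \<otimes>\<^bsub>A\<^esub> a = a \<and> a \<otimes>\<^bsub>A\<^esub> e = a"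
    using assms by (auto simp: unital_def)
  have 0: "vnorm A (a \<ominus>\<^bsub>A\<^esub> a) = 0" if "a \<in> carrier A" for a
    using that by (simp add: minus_A vnorm_zero)
  show ?thesis
    unfolding has_bounded_approximate_identity_def
    \<comment> \<open>The principal filter at e corresponds to the constant net.\<close>
    by (rule exI[of _ "principal {e}"], rule exI[of _ "vnorm A e"])
       (use e 0 in \<open>auto simp: eventually_principal principal_eq_bot_iff intro!: tendsto_eventually\<close>)
qed

lemma integral_square_eq_convolution:
  fixes \<phi> :: "'a \<Rightarrow> real"
  assumes "\<And>x. \<phi> (- x) = \<phi> x"
  shows "convolution \<mu> (\<lambda>x. of_real (\<phi> x)) (\<lambda>x. of_real (\<phi> x)) 0 = of_real (\<integral>x. (\<phi> x)\<^sup>2 \<partial>\<mu>)"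
proof -
  have "convolution \<mu> (\<lambda>x. of_real (\<phi> x)) (\<lambda>x. of_real (\<phi> x)) 0 = (\<integral>x. complex_of_real ((\<phi> x)\<^sup>2) \<partial>\<mu>)"
    by (simp add: convolution_def assms power2_eq_square)
  then show ?thesis by (simp only: integral_complex_of_real)
qed

lemma bounded_approximate_identity_imp_finite:
  assumes "has_bounded_approximate_identity A"
  shows "finite (UNIV :: 'a set)"
proof -
  obtain F K where F: "F \<noteq> bot" and K: "\<forall>\<^sub>F e in F. e \<in> carrier A \<and> vnorm A e \<le> K"
    and lim: "\<And>a. a \<in> carrier A \<Longrightarrow> ((\<lambda>e. vnorm A (e \<otimes>\<^bsub>A\<^esub> a \<ominus>\<^bsub>A\<^esub> a)) \<longlongrightarrow> 0) F"
    using assms unfolding has_bounded_approximate_identity_def by blast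
  show ?thesis
  proof (rule finite_if_L2_le_L1[of K])
    fix \<phi> :: "'a \<Rightarrow> real"
    assume \<phi>: "continuous_on UNIV \<phi>" "\<And>x. 0 \<le> \<phi> x" "\<And>x. \<phi> (- x) = \<phi> x"
    let ?s = "\<integral>x. (\<phi> x)\<^sup>2 \<partial>\<mu>" and ?t = "\<integral>x. \<phi> x \<partial>\<mu>"
    define f where "f = (\<lambda>x. complex_of_real (\<phi> x))"
    have f: "continuous_on UNIV f" "\<And>x. f (- x) = f x" and norm_f: "\<And>x. cmod (f x) = \<phi> x"
      using \<phi> by (auto simp: f_def intro!: continuous_intros)
    define a where "a = convolution \<mu> f f"
    have a: "a \<in> carrier A" "continuous_on UNIV a"
      unfolding a_def by (intro convolution_in_A continuous_convolution f)+
    have s: "a 0 = of_real ?s"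
      using integral_square_eq_convolution[of \<phi>] \<phi>(3) by (simp add: a_def f_def)
    show "?s \<le> K * ?t\<^sup>2"
    proof (rule field_le_epsilon)
      fix \<epsilon> :: real
      assume "0 < \<epsilon>"
      with lim[OF a(1)] have "\<forall>\<^sub>F e in F. vnorm A (e \<otimes>\<^bsub>A\<^esub> a \<ominus>\<^bsub>A\<^esub> a) < \<epsilon>"
        by (rule order_tendstoD)
      from eventually_happens'[OF F eventually_conj[OF K this]]
      obtain e where e: "e \<in> carrier A" "vnorm A e \<le> K" "vnorm A (e \<otimes>\<^bsub>A\<^esub> a \<ominus>\<^bsub>A\<^esub> a) < \<epsilon>"
        by blast
      have ce: "continuous_on UNIV e" using e(1) by (simp add: carrier_A)
      let ?ef = "convolution \<mu> e f"
      have cef: "continuous_on UNIV ?ef" by (intro continuous_convolution ce f)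
      have assoc: "convolution \<mu> e a = convolution \<mu> ?ef f"
        by (simp add: a_def convolution_assoc ce f)
      \<comment> \<open>The estimate \<open>norm_le_vnorm\<close> speaks of elements of the carrier.
        That e * a - a is one follows by writing it as the single convolution (e * f - f) *
        f.\<close>
      have "convolution \<mu> (\<lambda>x. ?ef x + (- 1) * f x) f
          = (\<lambda>x. convolution \<mu> ?ef f x + convolution \<mu> (\<lambda>x. (- 1) * f x) f x)"
        by (intro convolution_add(1) continuous_intros cef f)
      also have "\<dots> = (\<lambda>x. convolution \<mu> e a x - a x)"
        unfolding convolution_scale assoc by (simp add: a_def)
      finally have "(\<lambda>x. convolution \<mu> e a x - a x) = convolution \<mu> (\<lambda>x. ?ef x + (- 1) * f x) f" ..
      moreover have "\<dots> \<in> carrier A"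
        by (intro convolution_in_A continuous_intros cef f)
      ultimately have "e \<otimes>\<^bsub>A\<^esub> a \<ominus>\<^bsub>A\<^esub> a \<in> carrier A"
        by (simp add: minus_A[OF a(1)] A_simps)
      from norm_le_vnorm[OF this, of 0] e(3)
      have 1: "cmod (convolution \<mu> e a 0 - a 0) < \<epsilon>"
        by (simp add: minus_A[OF a(1)] A_simps)
      \<comment> \<open>From |e| at most K on, each right convolution by the symmetric f multiplies
        the supremum bound by the L1 norm of f.\<close>
      have "cmod (e x) \<le> K" for x
        using norm_le_vnorm[OF e(1), of x] e(2) by linarith
      then have "cmod (?ef x) \<le> K * ?t" for x
        using norm_convolution_symmetric_le[of e K f x] f norm_f by simp
      then have "cmod (convolution \<mu> ?ef f 0) \<le> K * ?t * ?t"
        using norm_convolution_symmetric_le[of ?ef "K * ?t" f 0] f norm_f by simp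
      then have 2: "cmod (convolution \<mu> e a 0) \<le> K * ?t\<^sup>2"
        by (simp add: assoc power2_eq_square mult.assoc)
      have "?s \<le> cmod (a 0)" by (simp add: s)
      also have "\<dots> \<le> cmod (convolution \<mu> e a 0) + cmod (convolution \<mu> e a 0 - a 0)"
        using norm_triangle_ineq4[of "convolution \<mu> e a 0" "convolution \<mu> e a 0 - a 0"] by simp
      also have "\<dots> \<le> K * ?t\<^sup>2 + \<epsilon>" using 1 2 by linarith
      finally show "?s \<le> K * ?t\<^sup>2 + \<epsilon>" .
    qed
  qed
qed

end

section \<open>Duals of complex normed spaces\<close>

lemma complex_ring_simps [simp]:
  "carrier complex_ring = UNIV" "mult complex_ring = (*)" "one complex_ring = 1"
  "zero complex_ring = 0" "add complex_ring = (+)"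
  by (simp_all add: complex_ring_def)

lemma cring_complex_ring: "cring complex_ring"
proof (rule cringI)
  show "abelian_group complex_ring"
    by (rule abelian_groupI) (auto simp: algebra_simps intro: exI[of _ "- x" for x])
  show "Group.comm_monoid complex_ring"
    by (rule comm_monoidI) (auto simp: algebra_simps)
qed (simp add: algebra_simps)

lemma dual_simps [simp]:
  "carrier (dual X) = dual_carrier X" "zero (dual X) = (\<lambda>x\<in>carrier X. 0)"
  "\<phi> \<oplus>\<^bsub>dual X\<^esub> \<psi> = (\<lambda>x\<in>carrier X. \<phi> x + \<psi> x)" "c \<odot>\<^bsub>dual X\<^esub> \<phi> = (\<lambda>x\<in>carrier X. c * \<phi> x)"
  by (simp_all add: dual_def)

lemma vnorm_dual: "vnorm (dual X) \<phi> = (SUP x\<in>{x \<in> carrier X. vnorm X x \<le> 1}. cmod (\<phi> x))"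
  by (simp add: dual_def)

lemma dual_carrierD:
  assumes "\<phi> \<in> dual_carrier X"
  shows "\<phi> \<in> extensional (carrier X)"
    "x \<in> carrier X \<Longrightarrow> y \<in> carrier X \<Longrightarrow> \<phi> (x \<oplus>\<^bsub>X\<^esub> y) = \<phi> x + \<phi> y"
    "x \<in> carrier X \<Longrightarrow> \<phi> (c \<odot>\<^bsub>X\<^esub> x) = c * \<phi> x"
  using assms by (auto simp: dual_carrier_def)

context complex_normed_space
begin

lemma vnorm_zero [simp]: "vnorm X \<zero> = 0"
  using vnorm_eq_0[of \<zero>] by simp

lemma smult_in_carrier [simp]: "x \<in> carrier X \<Longrightarrow> c \<odot> x \<in> carrier X"
  using smult_closed[of c x] by simp

lemma dual_carrierE:
  assumes "\<phi> \<in> dual_carrier X"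
  obtains K where "0 \<le> K" "\<And>x. x \<in> carrier X \<Longrightarrow> cmod (\<phi> x) \<le> K * vnorm X x"
proof -
  obtain K where K: "\<And>x. x \<in> carrier X \<Longrightarrow> cmod (\<phi> x) \<le> K * vnorm X x"
    using assms unfolding dual_carrier_def by blast
  have "cmod (\<phi> x) \<le> \<bar>K\<bar> * vnorm X x" if "x \<in> carrier X" for x
    using K[OF that] mult_right_mono[OF abs_ge_self[of K] vnorm_nonneg[OF that]] by linarith
  then show thesis by (intro that[of "\<bar>K\<bar>"]) auto
qed

lemma dual_carrierI:
  assumes "\<And>x y. x \<in> carrier X \<Longrightarrow> y \<in> carrier X \<Longrightarrow> f (x \<oplus> y) = f x + f y"
    and "\<And>c x. x \<in> carrier X \<Longrightarrow> f (c \<odot> x) = c * f x"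
    and "\<And>x. x \<in> carrier X \<Longrightarrow> cmod (f x) \<le> K * vnorm X x"
  shows "(\<lambda>x\<in>carrier X. f x) \<in> dual_carrier X"
  unfolding dual_carrier_def using assms by (auto intro!: exI[of _ K])

lemma dual_at_zero:
  assumes "\<phi> \<in> dual_carrier X"
  shows "\<phi> \<zero> = 0"
  using dual_carrierD(2)[OF assms, of \<zero> \<zero>] by simp

lemma dual_norm_le:
  assumes "0 \<le> K" "\<And>x. x \<in> carrier X \<Longrightarrow> cmod (\<phi> x) \<le> K * vnorm X x"
  shows "vnorm (dual X) \<phi> \<le> K"
  unfolding vnorm_dual
proof (rule cSUP_least)
  show "{x \<in> carrier X. vnorm X x \<le> 1} \<noteq> {}"
    using vnorm_zero by (metis (mono_tags, lifting) M.zero_closed empty_iff mem_Collect_eq zero_le_one)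
  fix x assume x: "x \<in> {x \<in> carrier X. vnorm X x \<le> 1}"
  then have "cmod (\<phi> x) \<le> K * vnorm X x" using assms(2) by simp
  also have "\<dots> \<le> K * 1" using x assms(1) by (intro mult_left_mono) auto
  finally show "cmod (\<phi> x) \<le> K" by simp
qed

text \<open>Scaling x to norm 1 places it under the supremum, which is a supremum of reals and
  bounded because the functional is.\<close>

lemma dual_norm_bound:
  assumes \<phi>: "\<phi> \<in> dual_carrier X" and x: "x \<in> carrier X"
  shows "cmod (\<phi> x) \<le> vnorm (dual X) \<phi> * vnorm X x"
proof (cases "x = \<zero>")
  case True
  then show ?thesis using dual_at_zero[OF \<phi>] by simp
next
  case False
  then have pos: "0 < vnorm X x" using vnorm_nonneg[OF x] vnorm_eq_0[OF x] by simp
  obtain K where K: "0 \<le> K" "\<And>x. x \<in> carrier X \<Longrightarrow> cmod (\<phi> x) \<le> K * vnorm X x"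
    by (rule dual_carrierE[OF \<phi>]) blast
  have bdd: "bdd_above ((\<lambda>x. cmod (\<phi> x)) ` {x \<in> carrier X. vnorm X x \<le> 1})"
    using K(2) mult_left_mono[OF _ K(1), of _ 1] by (auto intro!: bdd_aboveI[of _ K] intro: order_trans)
  define c where "c = complex_of_real (1 / vnorm X x)"
  have c: "cmod c = 1 / vnorm X x" using pos by (simp add: c_def norm_divide)
  have "cmod (\<phi> (c \<odot> x)) \<le> vnorm (dual X) \<phi>"
    unfolding vnorm_dual
    by (rule cSUP_upper[OF _ bdd]) (use x pos in \<open>simp add: vnorm_smult c\<close>)
  then show ?thesis
    using pos by (simp add: dual_carrierD(3)[OF \<phi> x] norm_mult c divide_le_eq)
qed

lemma dual_norm_nonneg:
  assumes "\<phi> \<in> dual_carrier X"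
  shows "0 \<le> vnorm (dual X) \<phi>"
proof -
  obtain K where K: "0 \<le> K" "\<And>x. x \<in> carrier X \<Longrightarrow> cmod (\<phi> x) \<le> K * vnorm X x"
    by (rule dual_carrierE[OF assms]) blast
  have "bdd_above ((\<lambda>x. cmod (\<phi> x)) ` {x \<in> carrier X. vnorm X x \<le> 1})"
    using K(2) mult_left_mono[OF _ K(1), of _ 1] by (auto intro!: bdd_aboveI[of _ K] intro: order_trans)
  from cSUP_upper[OF _ this, of \<zero>] show ?thesis
    by (simp add: vnorm_dual dual_at_zero[OF assms])
qed

lemma dual_add_closed:
  assumes "\<phi> \<in> dual_carrier X" "\<psi> \<in> dual_carrier X"
  shows "(\<lambda>x\<in>carrier X. \<phi> x + \<psi> x) \<in> dual_carrier X"
proof (rule dual_carrierI[of _ "vnorm (dual X) \<phi> + vnorm (dual X) \<psi>"])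
  fix x assume x: "x \<in> carrier X"
  show "cmod (\<phi> x + \<psi> x) \<le> (vnorm (dual X) \<phi> + vnorm (dual X) \<psi>) * vnorm X x"
    using norm_triangle_ineq[of "\<phi> x" "\<psi> x"] dual_norm_bound[OF assms(1) x] dual_norm_bound[OF assms(2) x]
    by (simp add: distrib_right)
qed (simp_all add: dual_carrierD[OF assms(1)] dual_carrierD[OF assms(2)] algebra_simps)

lemma dual_scale_closed:
  assumes "\<phi> \<in> dual_carrier X"
  shows "(\<lambda>x\<in>carrier X. c * \<phi> x) \<in> dual_carrier X"
proof (rule dual_carrierI[of _ "cmod c * vnorm (dual X) \<phi>"])
  fix x assume x: "x \<in> carrier X"
  show "cmod (c * \<phi> x) \<le> cmod c * vnorm (dual X) \<phi> * vnorm X x"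
    using mult_left_mono[OF dual_norm_bound[OF assms x], of "cmod c"] by (simp add: norm_mult mult.assoc)
qed (simp_all add: dual_carrierD[OF assms] algebra_simps)

lemma dual_zero_closed: "(\<lambda>x\<in>carrier X. 0) \<in> dual_carrier X"
  by (rule dual_carrierI[of _ 0]) simp_all

lemma dual_abelian_group: "abelian_group (dual X)"
proof (rule abelian_groupI)
  fix \<phi> assume \<phi>: "\<phi> \<in> carrier (dual X)"
  then show "\<exists>\<psi>\<in>carrier (dual X). \<psi> \<oplus>\<^bsub>dual X\<^esub> \<phi> = \<zero>\<^bsub>dual X\<^esub>"
    using dual_scale_closed[of \<phi> "- 1"]
    by (intro bexI[of _ "\<lambda>x\<in>carrier X. - 1 * \<phi> x"]) (auto simp: fun_eq_iff restrict_def)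
  show "\<zero>\<^bsub>dual X\<^esub> \<oplus>\<^bsub>dual X\<^esub> \<phi> = \<phi>"
    using dual_carrierD(1)[of \<phi> X] \<phi> by (auto simp: extensional_def)
qed (auto simp: dual_add_closed dual_zero_closed algebra_simps intro!: restrict_ext)

lemma dual_minus:
  assumes "\<psi> \<in> dual_carrier X"
  shows "\<phi> \<ominus>\<^bsub>dual X\<^esub> \<psi> = (\<lambda>x\<in>carrier X. \<phi> x - \<psi> x)"
proof -
  interpret D: abelian_group "dual X" by (rule dual_abelian_group)
  have "\<ominus>\<^bsub>dual X\<^esub> \<psi> = (\<lambda>x\<in>carrier X. - 1 * \<psi> x)"
    by (rule D.minus_equality) (use assms dual_scale_closed[of \<psi> "- 1"] in \<open>auto intro!: restrict_ext\<close>)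
  then show ?thesis by (auto simp: a_minus_def intro!: restrict_ext)
qed

lemma dual_minus_closed:
  assumes "\<phi> \<in> dual_carrier X" "\<psi> \<in> dual_carrier X"
  shows "(\<lambda>x\<in>carrier X. \<phi> x - \<psi> x) \<in> dual_carrier X"
proof -
  interpret D: abelian_group "dual X" by (rule dual_abelian_group)
  show ?thesis using D.minus_closed[of \<phi> \<psi>] assms by (simp add: dual_minus)
qed

lemma dual_normed_space: "complex_normed_space (dual X)"
proof (rule complex_normed_space.intro)
  show "Module.module complex_ring (dual X)"
  proof (rule moduleI)
    show "cring complex_ring" by (rule cring_complex_ring)
    show "abelian_group (dual X)" by (rule dual_abelian_group)
    fix \<phi> assume "\<phi> \<in> carrier (dual X)"
    then show "\<one>\<^bsub>complex_ring\<^esub> \<odot>\<^bsub>dual X\<^esub> \<phi> = \<phi>"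
      using dual_carrierD(1)[of \<phi> X] by (auto simp: extensional_def)
  qed (auto simp: dual_scale_closed algebra_simps intro!: restrict_ext)
  show "complex_normed_space_axioms (dual X)"
  proof
    fix \<phi> \<psi> c
    assume \<phi>: "\<phi> \<in> carrier (dual X)"
    then have \<phi>': "\<phi> \<in> dual_carrier X" by simp
    note b = dual_norm_bound[OF \<phi>']
    show nonneg: "0 \<le> vnorm (dual X) \<phi>" by (rule dual_norm_nonneg[OF \<phi>'])
    show "vnorm (dual X) \<phi> = 0 \<longleftrightarrow> \<phi> = \<zero>\<^bsub>dual X\<^esub>"
    proof
      assume "vnorm (dual X) \<phi> = 0"
      then have "\<phi> x = 0" if "x \<in> carrier X" for x using b[OF that] by simp
      then show "\<phi> = \<zero>\<^bsub>dual X\<^esub>"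
        using dual_carrierD(1)[OF \<phi>'] by (auto simp: extensional_def)
    next
      assume "\<phi> = \<zero>\<^bsub>dual X\<^esub>"
      then have "vnorm (dual X) \<phi> \<le> 0" by (intro dual_norm_le) auto
      then show "vnorm (dual X) \<phi> = 0" using nonneg by simp
    qed
    have le: "vnorm (dual X) (c \<odot>\<^bsub>dual X\<^esub> \<phi>) \<le> cmod c * vnorm (dual X) \<phi>" if "\<phi> \<in> dual_carrier X" for c \<phi>
      by (rule dual_norm_le)
         (use mult_left_mono[OF dual_norm_bound[OF that], of _ "cmod c"] dual_norm_nonneg[OF that]
           in \<open>auto simp: norm_mult mult.assoc\<close>)
    show "vnorm (dual X) (c \<odot>\<^bsub>dual X\<^esub> \<phi>) = cmod c * vnorm (dual X) \<phi>"
    proof (rule antisym)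
      show "vnorm (dual X) (c \<odot>\<^bsub>dual X\<^esub> \<phi>) \<le> cmod c * vnorm (dual X) \<phi>"
        by (rule le[OF \<phi>'])
      show "cmod c * vnorm (dual X) \<phi> \<le> vnorm (dual X) (c \<odot>\<^bsub>dual X\<^esub> \<phi>)"
      proof (cases "c = 0")
        case True
        then show ?thesis using dual_norm_nonneg[OF dual_scale_closed[OF \<phi>', of c]] by simp
      next
        \<comment> \<open>The reverse inequality is the inequality \<open>le\<close> applied to
          \<open>inverse c\<close> and the scaled functional.\<close>
        case False
        have "inverse c \<odot>\<^bsub>dual X\<^esub> (c \<odot>\<^bsub>dual X\<^esub> \<phi>) = \<phi>"
          using False dual_carrierD(1)[OF \<phi>'] by (auto simp: extensional_def)
        then have "vnorm (dual X) \<phi> \<le> cmod (inverse c) * vnorm (dual X) (c \<odot>\<^bsub>dual X\<^esub> \<phi>)"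
          using le[OF dual_scale_closed[OF \<phi>', of c], of "inverse c"] by (simp del: restrict_apply)
        then show ?thesis using False by (simp add: norm_divide field_simps)
      qed
    qed
    assume "\<psi> \<in> carrier (dual X)"
    then have \<psi>: "\<psi> \<in> dual_carrier X" by simp
    show "vnorm (dual X) (\<phi> \<oplus>\<^bsub>dual X\<^esub> \<psi>) \<le> vnorm (dual X) \<phi> + vnorm (dual X) \<psi>"
    proof (rule dual_norm_le)
      fix x assume x: "x \<in> carrier X"
      show "cmod ((\<phi> \<oplus>\<^bsub>dual X\<^esub> \<psi>) x) \<le> (vnorm (dual X) \<phi> + vnorm (dual X) \<psi>) * vnorm X x"
        using x norm_triangle_ineq[of "\<phi> x" "\<psi> x"] b[OF x] dual_norm_bound[OF \<psi> x]
        by (simp add: distrib_right)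
    qed (use nonneg dual_norm_nonneg[OF \<psi>] in simp)
  qed
qed

text \<open>A Cauchy sequence of functionals converges pointwise. Fixing one index in the Cauchy
  estimate and letting the other tend to infinity gives convergence in norm to the pointwise
  limit.\<close>

lemma dual_banach_space: "complex_banach_space (dual X)"
proof (rule complex_banach_space.intro[OF dual_normed_space], unfold_locales)
  fix s :: "nat \<Rightarrow> 'b \<Rightarrow> complex"
  assume "\<And>n. s n \<in> carrier (dual X)"
  then have s: "s n \<in> dual_carrier X" for n by simp
  assume cauchy: "\<And>\<epsilon>. \<epsilon> > 0 \<Longrightarrow> \<exists>N. \<forall>m\<ge>N. \<forall>n\<ge>N. vnorm (dual X) (s m \<ominus>\<^bsub>dual X\<^esub> s n) < \<epsilon>"
  have diff: "cmod (s m x - s n x) \<le> vnorm (dual X) (s m \<ominus>\<^bsub>dual X\<^esub> s n) * vnorm X x"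
    if "x \<in> carrier X" for m n x
    using dual_norm_bound[OF dual_minus_closed[OF s[of m] s[of n]] that] that by (simp add: dual_minus s)
  have close: "\<exists>N. \<forall>m\<ge>N. \<forall>n\<ge>N. \<forall>x\<in>carrier X. cmod (s m x - s n x) \<le> e * vnorm X x" if e: "0 < e" for e
  proof -
    obtain N where N: "\<And>m n. N \<le> m \<Longrightarrow> N \<le> n \<Longrightarrow> vnorm (dual X) (s m \<ominus>\<^bsub>dual X\<^esub> s n) < e"
      using cauchy[OF e] by blast
    have "cmod (s m x - s n x) \<le> e * vnorm X x" if "N \<le> m" "N \<le> n" "x \<in> carrier X" for m n x
      using diff[OF that(3), of m n] mult_right_mono[OF less_imp_le[OF N[OF that(1,2)]] vnorm_nonneg[OF that(3)]]
      by linarith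
    then show ?thesis by blast
  qed
  have "convergent (\<lambda>n. s n x)" if x: "x \<in> carrier X" for x
  proof (rule Cauchy_convergent, rule CauchyI)
    fix e :: real assume e: "0 < e"
    \<comment> \<open>The summand 1 keeps the denominator positive when x has norm 0.\<close>
    define d where "d = e / (vnorm X x + 1)"
    have d: "0 < d" "d * vnorm X x < e"
      using e vnorm_nonneg[OF x] by (auto simp: d_def field_simps)
    obtain N where "\<forall>m\<ge>N. \<forall>n\<ge>N. \<forall>x\<in>carrier X. cmod (s m x - s n x) \<le> d * vnorm X x"
      using close[OF d(1)] by blast
    then have "\<forall>m\<ge>N. \<forall>n\<ge>N. cmod (s m x - s n x) < e"
      using d(2) x by (meson le_less_trans)
    then show "\<exists>N. \<forall>m\<ge>N. \<forall>n\<ge>N. cmod (s m x - s n x) < e" by blast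
  qed
  then have lim: "(\<lambda>n. s n x) \<longlonglongrightarrow> lim (\<lambda>n. s n x)" if "x \<in> carrier X" for x
    using that by (simp add: convergent_LIMSEQ_iff)
  define \<phi> where "\<phi> = (\<lambda>x\<in>carrier X. lim (\<lambda>n. s n x))"
  have \<phi>_eq: "\<phi> x = lim (\<lambda>n. s n x)" if "x \<in> carrier X" for x
    using that by (simp add: \<phi>_def)
  have le: "\<exists>N. \<forall>n\<ge>N. \<forall>x\<in>carrier X. cmod (s n x - lim (\<lambda>n. s n x)) \<le> e * vnorm X x" if e: "0 < e" for e
  proof -
    obtain N where N: "\<forall>m\<ge>N. \<forall>n\<ge>N. \<forall>x\<in>carrier X. cmod (s m x - s n x) \<le> e * vnorm X x"
      using close[OF e] by blast
    have "cmod (s n x - lim (\<lambda>n. s n x)) \<le> e * vnorm X x" if n: "N \<le> n" and x: "x \<in> carrier X" for n x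
    proof (rule tendsto_upperbound)
      show "(\<lambda>m. cmod (s n x - s m x)) \<longlonglongrightarrow> cmod (s n x - lim (\<lambda>n. s n x))"
        by (intro tendsto_intros lim x)
      show "\<forall>\<^sub>F m in sequentially. cmod (s n x - s m x) \<le> e * vnorm X x"
        using N n x by (auto simp: eventually_sequentially)
    qed simp
    then show ?thesis by blast
  qed
  \<comment> \<open>The limit is bounded because it lies within distance 1 of some
    \<open>s N\<close>.\<close>
  have \<phi>: "\<phi> \<in> dual_carrier X"
  proof -
    obtain N where N: "\<And>x. x \<in> carrier X \<Longrightarrow> cmod (s N x - lim (\<lambda>n. s n x)) \<le> 1 * vnorm X x"
      using le[of 1] by auto
    show ?thesis unfolding \<phi>_def
    proof (rule dual_carrierI[of _ "vnorm (dual X) (s N) + 1"])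
      fix x y assume x: "x \<in> carrier X" and y: "y \<in> carrier X"
      have "(\<lambda>n. s n x + s n y) \<longlonglongrightarrow> lim (\<lambda>n. s n x) + lim (\<lambda>n. s n y)"
        by (intro tendsto_intros lim x y)
      then have "(\<lambda>n. s n (x \<oplus> y)) \<longlonglongrightarrow> lim (\<lambda>n. s n x) + lim (\<lambda>n. s n y)"
        by (simp add: dual_carrierD(2)[OF s x y])
      then show "lim (\<lambda>n. s n (x \<oplus> y)) = lim (\<lambda>n. s n x) + lim (\<lambda>n. s n y)" by (rule limI)
    next
      fix c x assume x: "x \<in> carrier X"
      have "(\<lambda>n. c * s n x) \<longlonglongrightarrow> c * lim (\<lambda>n. s n x)"
        by (intro tendsto_intros lim x)
      then have "(\<lambda>n. s n (c \<odot> x)) \<longlonglongrightarrow> c * lim (\<lambda>n. s n x)"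
        by (simp add: dual_carrierD(3)[OF s x])
      then show "lim (\<lambda>n. s n (c \<odot> x)) = c * lim (\<lambda>n. s n x)" by (rule limI)
    next
      fix x assume x: "x \<in> carrier X"
      show "cmod (lim (\<lambda>n. s n x)) \<le> (vnorm (dual X) (s N) + 1) * vnorm X x"
        using N[OF x] dual_norm_bound[OF s[of N] x] norm_triangle_ineq4[of "s N x" "s N x - lim (\<lambda>n. s n x)"]
        by (simp add: distrib_right)
    qed
  qed
  have "(\<lambda>n. vnorm (dual X) (s n \<ominus>\<^bsub>dual X\<^esub> \<phi>)) \<longlonglongrightarrow> 0"
  proof (rule LIMSEQ_I)
    fix e :: real assume e: "0 < e"
    obtain N where N: "\<forall>n\<ge>N. \<forall>x\<in>carrier X. cmod (s n x - lim (\<lambda>n. s n x)) \<le> e / 2 * vnorm X x"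
      using le[of "e / 2"] e by auto
    have "norm (vnorm (dual X) (s n \<ominus>\<^bsub>dual X\<^esub> \<phi>) - 0) < e" if n: "N \<le> n" for n
    proof -
      have "vnorm (dual X) (s n \<ominus>\<^bsub>dual X\<^esub> \<phi>) \<le> e / 2"
        by (rule dual_norm_le) (use N n e in \<open>auto simp: dual_minus[OF \<phi>] \<phi>_eq\<close>)
      moreover have "0 \<le> vnorm (dual X) (s n \<ominus>\<^bsub>dual X\<^esub> \<phi>)"
        by (simp add: dual_minus[OF \<phi>] dual_norm_nonneg[OF dual_minus_closed[OF s \<phi>]])
      ultimately show ?thesis using e by simp
    qed
    then show "\<exists>N. \<forall>n\<ge>N. norm (vnorm (dual X) (s n \<ominus>\<^bsub>dual X\<^esub> \<phi>) - 0) < e" by blast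
  qed
  with \<phi> show "\<exists>\<phi>\<in>carrier (dual X). (\<lambda>n. vnorm (dual X) (s n \<ominus>\<^bsub>dual X\<^esub> \<phi>)) \<longlonglongrightarrow> 0" by auto
qed

end

text \<open>A copy of X along an injection h with left inverse k. Amenability ranges over modules
  carried by one fixed type, and the copy brings a space of functionals into that type.\<close>

definition transport ::
  "('b \<Rightarrow> 'd) \<Rightarrow> ('d \<Rightarrow> 'b) \<Rightarrow> ('b, 'm) normed_cmodule_scheme \<Rightarrow> 'd normed_cmodule" where
  "transport h k X = \<lparr>carrier = h ` carrier X, mult = undefined, one = undefined, zero = h \<zero>\<^bsub>X\<^esub>,
     add = (\<lambda>x y. h (k x \<oplus>\<^bsub>X\<^esub> k y)), smult = (\<lambda>c x. h (c \<odot>\<^bsub>X\<^esub> k x)), vnorm = (\<lambda>x. vnorm X (k x))\<rparr>"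

lemma transport_simps [simp]:
  "carrier (transport h k X) = h ` carrier X" "\<zero>\<^bsub>transport h k X\<^esub> = h \<zero>\<^bsub>X\<^esub>"
  "x \<oplus>\<^bsub>transport h k X\<^esub> y = h (k x \<oplus>\<^bsub>X\<^esub> k y)" "c \<odot>\<^bsub>transport h k X\<^esub> x = h (c \<odot>\<^bsub>X\<^esub> k x)"
  "vnorm (transport h k X) x = vnorm X (k x)"
  by (simp_all add: transport_def)

lemma (in complex_banach_space) transport_banach_space:
  fixes h :: "_ \<Rightarrow> 'd"
  assumes k [simp]: "\<And>x. k (h x) = x"
  shows "complex_banach_space (transport h k X)"
proof -
  have inj: "h x = h y \<longleftrightarrow> x = y" for x y by (metis k)
  have ab: "abelian_group (transport h k X)"
  proof (rule abelian_groupI)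
    fix x assume "x \<in> carrier (transport h k X)"
    then show "\<exists>y\<in>carrier (transport h k X). y \<oplus>\<^bsub>transport h k X\<^esub> x = \<zero>\<^bsub>transport h k X\<^esub>"
      by (auto intro!: bexI[of _ "\<ominus> k x"] simp: M.l_neg)
  qed (auto simp: M.a_assoc M.a_comm M.a_lcomm)
  interpret T: abelian_group "transport h k X" by (rule ab)
  have uminus: "\<ominus>\<^bsub>transport h k X\<^esub> (h x) = h (\<ominus> x)" if "x \<in> carrier X" for x
    by (rule T.minus_equality) (use that in \<open>auto simp: M.l_neg\<close>)
  have minus: "h x \<ominus>\<^bsub>transport h k X\<^esub> h y = h (x \<ominus> y)" if "y \<in> carrier X" for x y
    using that by (simp add: a_minus_def uminus)
  show ?thesis
  proof (intro complex_banach_space.intro complex_normed_space.intro)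
    show "Module.module complex_ring (transport h k X)"
    proof (rule moduleI)
      fix c d x assume "x \<in> carrier (transport h k X)"
      then show "(c \<oplus>\<^bsub>complex_ring\<^esub> d) \<odot>\<^bsub>transport h k X\<^esub> x
          = c \<odot>\<^bsub>transport h k X\<^esub> x \<oplus>\<^bsub>transport h k X\<^esub> d \<odot>\<^bsub>transport h k X\<^esub> x"
        using smult_l_distr[of c d "k x"] by auto
    next
      fix c d x assume "x \<in> carrier (transport h k X)"
      then show "(c \<otimes>\<^bsub>complex_ring\<^esub> d) \<odot>\<^bsub>transport h k X\<^esub> x
          = c \<odot>\<^bsub>transport h k X\<^esub> (d \<odot>\<^bsub>transport h k X\<^esub> x)"
        using smult_assoc1[of c d "k x"] by auto
    next
      fix x assume "x \<in> carrier (transport h k X)"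
      then show "\<one>\<^bsub>complex_ring\<^esub> \<odot>\<^bsub>transport h k X\<^esub> x = x"
        using smult_one[of "k x"] by auto
    qed (auto simp: cring_complex_ring ab smult_r_distr)
    show "complex_normed_space_axioms (transport h k X)"
      by standard (auto simp: vnorm_nonneg vnorm_eq_0 vnorm_triangle vnorm_smult inj)
    show "complex_banach_space_axioms (transport h k X)"
    proof
      fix s :: "nat \<Rightarrow> 'd"
      assume s: "\<And>n. s n \<in> carrier (transport h k X)"
        and cauchy: "\<And>\<epsilon>. \<epsilon> > 0 \<Longrightarrow>
          \<exists>N. \<forall>m\<ge>N. \<forall>n\<ge>N. vnorm (transport h k X) (s m \<ominus>\<^bsub>transport h k X\<^esub> s n) < \<epsilon>"
      have ks: "k (s n) \<in> carrier X" "s n = h (k (s n))" for n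
        using s[of n] by auto
      have sm: "s m \<ominus>\<^bsub>transport h k X\<^esub> h x = h (k (s m) \<ominus> x)" if "x \<in> carrier X" for m x
        using minus[OF that, of "k (s m)"] ks(2)[of m] by simp
      have "\<exists>x\<in>carrier X. (\<lambda>n. vnorm X (k (s n) \<ominus> x)) \<longlonglongrightarrow> 0"
      proof (rule complete)
        fix \<epsilon> :: real assume "\<epsilon> > 0"
        from cauchy[OF this] show "\<exists>N. \<forall>m\<ge>N. \<forall>n\<ge>N. vnorm X (k (s m) \<ominus> k (s n)) < \<epsilon>"
          using sm[OF ks(1)] by (simp flip: ks(2))
      qed (rule ks)
      then obtain x where x: "x \<in> carrier X" "(\<lambda>n. vnorm X (k (s n) \<ominus> x)) \<longlonglongrightarrow> 0" by blast
      then show "\<exists>x\<in>carrier (transport h k X).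
          (\<lambda>n. vnorm (transport h k X) (s n \<ominus>\<^bsub>transport h k X\<^esub> x)) \<longlonglongrightarrow> 0"
        by (intro bexI[of _ "h x"]) (simp_all add: sm)
    qed
  qed
qed

section \<open>The continuous functions on a compact space with the supremum norm\<close>

definition continuous_functions :: "('a::topological_space \<Rightarrow> complex) normed_cmodule" where
  "continuous_functions = \<lparr>carrier = {u. continuous_on UNIV u}, mult = undefined, one = undefined,
     zero = (\<lambda>x. 0), add = (\<lambda>u v x. u x + v x), smult = (\<lambda>c u x. c * u x),
     vnorm = (\<lambda>u. SUP x. cmod (u x))\<rparr>"

lemma continuous_functions_simps [simp]:
  "u \<in> carrier continuous_functions \<longleftrightarrow> continuous_on UNIV u"
  "\<zero>\<^bsub>continuous_functions\<^esub> = (\<lambda>x. 0)"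
  "u \<oplus>\<^bsub>continuous_functions\<^esub> v = (\<lambda>x. u x + v x)"
  "c \<odot>\<^bsub>continuous_functions\<^esub> u = (\<lambda>x. c * u x)"
  by (simp_all add: continuous_functions_def)

lemma vnorm_continuous_functions: "vnorm continuous_functions u = (SUP x. cmod (u x))"
  by (simp add: continuous_functions_def)

lemma sup_norm_upper:
  assumes "compact (UNIV :: 'a::topological_space set)" "continuous_on UNIV (u :: 'a \<Rightarrow> complex)"
  shows "cmod (u x) \<le> vnorm continuous_functions u"
proof -
  have "bounded (range u)"
    by (intro compact_imp_bounded compact_continuous_image assms)
  then have "bdd_above (range (\<lambda>x. cmod (u x)))"
    by (auto simp: bounded_iff bdd_above_def)
  then show ?thesis
    unfolding vnorm_continuous_functions by (intro cSUP_upper) auto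
qed

lemma sup_norm_least:
  "(\<And>x. cmod (u x) \<le> c) \<Longrightarrow> vnorm continuous_functions u \<le> c"
  unfolding vnorm_continuous_functions by (rule cSUP_least) auto

lemma continuous_functions_normed_space:
  assumes c: "compact (UNIV :: 'a::topological_space set)"
  shows "complex_normed_space (continuous_functions :: ('a \<Rightarrow> complex) normed_cmodule)"
    (is "complex_normed_space ?C")
proof (rule complex_normed_space.intro)
  have ab: "abelian_group ?C"
  proof (rule abelian_groupI)
    fix u assume "u \<in> carrier ?C"
    then show "\<exists>v\<in>carrier ?C. v \<oplus>\<^bsub>?C\<^esub> u = \<zero>\<^bsub>?C\<^esub>"
      by (intro bexI[of _ "\<lambda>x. - u x"]) (auto intro!: continuous_intros)
  qed (auto simp: add.assoc add.commute intro!: continuous_intros)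
  show "Module.module complex_ring ?C"
    by (rule moduleI) (auto simp: cring_complex_ring ab algebra_simps intro!: continuous_intros)
  show "complex_normed_space_axioms ?C"
  proof
    fix u v :: "'a \<Rightarrow> complex" and k
    assume "u \<in> carrier ?C"
    then have u: "continuous_on UNIV u" by simp
    note up = sup_norm_upper[OF c u]
    show nonneg: "0 \<le> vnorm ?C u" using up[of undefined] norm_ge_zero order_trans by blast
    show "vnorm ?C u = 0 \<longleftrightarrow> u = \<zero>\<^bsub>?C\<^esub>"
    proof
      assume "vnorm ?C u = 0"
      then have "u x = 0" for x using up[of x] by simp
      then show "u = \<zero>\<^bsub>?C\<^esub>" by auto
    qed (simp add: vnorm_continuous_functions)
    show "vnorm ?C (k \<odot>\<^bsub>?C\<^esub> u) = cmod k * vnorm ?C u"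
    proof (rule antisym)
      show "vnorm ?C (k \<odot>\<^bsub>?C\<^esub> u) \<le> cmod k * vnorm ?C u"
        by (rule sup_norm_least) (simp add: norm_mult mult_left_mono up)
      show "cmod k * vnorm ?C u \<le> vnorm ?C (k \<odot>\<^bsub>?C\<^esub> u)"
      proof (cases "k = 0")
        case True
        then show ?thesis by (simp add: vnorm_continuous_functions)
      next
        case False
        have ku: "continuous_on UNIV (\<lambda>x. k * u x)" by (intro continuous_intros u)
        have "vnorm ?C u \<le> vnorm ?C (\<lambda>x. k * u x) / cmod k"
        proof (rule sup_norm_least)
          fix x
          show "cmod (u x) \<le> vnorm ?C (\<lambda>x. k * u x) / cmod k"
            using sup_norm_upper[OF c ku, of x] False by (simp add: norm_mult field_simps)
        qed
        then show ?thesis using False by (simp add: field_simps)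
      qed
    qed
    assume "v \<in> carrier ?C"
    then have v: "continuous_on UNIV v" by simp
    show "vnorm ?C (u \<oplus>\<^bsub>?C\<^esub> v) \<le> vnorm ?C u + vnorm ?C v"
    proof (rule sup_norm_least)
      fix x
      show "cmod ((u \<oplus>\<^bsub>?C\<^esub> v) x) \<le> vnorm ?C u + vnorm ?C v"
        using norm_triangle_ineq[of "u x" "v x"] up[of x] sup_norm_upper[OF c v, of x] by simp
    qed
  qed
qed

text \<open>Provides the average over the group in the proof for finite groups.\<close>

lemma (in complex_normed_space) dual_sum_closed:
  assumes "finite S" "\<And>i. i \<in> S \<Longrightarrow> \<phi> i \<in> dual_carrier X"
  shows "(\<lambda>x\<in>carrier X. \<Sum>i\<in>S. \<phi> i x) \<in> dual_carrier X"
  using assms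
proof (induction S)
  case empty
  then show ?case using dual_zero_closed by (simp only: sum.empty)
next
  case (insert i S)
  then have "(\<lambda>x\<in>carrier X. \<phi> i x + (\<lambda>x\<in>carrier X. \<Sum>i\<in>S. \<phi> i x) x) \<in> dual_carrier X"
    by (intro dual_add_closed) auto
  moreover have "(\<lambda>x\<in>carrier X. \<phi> i x + (\<lambda>x\<in>carrier X. \<Sum>i\<in>S. \<phi> i x) x)
      = (\<lambda>x\<in>carrier X. \<Sum>i\<in>insert i S. \<phi> i x)"
    using insert.hyps by (intro restrict_ext) simp
  ultimately show ?case by (simp only:)
qed

section \<open>Actions on the dual of a bimodule\<close>

context banach_bimodule
begin

lemma dual_left_closed:
  assumes "\<phi> \<in> dual_carrier X" "a \<in> carrier A"
  shows "dual_left X r a \<phi> \<in> dual_carrier X"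
proof -
  obtain K where K: "\<And>a x. a \<in> carrier A \<Longrightarrow> x \<in> carrier X \<Longrightarrow> vnorm X (r x a) \<le> K * vnorm A a * vnorm X x"
    using r_bounded by blast
  show ?thesis unfolding dual_left_def
  proof (rule dual_carrierI)
    fix x assume x: "x \<in> carrier X"
    have "cmod (\<phi> (r x a)) \<le> vnorm (dual X) \<phi> * vnorm X (r x a)"
      by (intro dual_norm_bound assms r_closed x)
    also have "\<dots> \<le> vnorm (dual X) \<phi> * (K * vnorm A a * vnorm X x)"
      by (intro mult_left_mono K assms x dual_norm_nonneg)
    finally show "cmod (\<phi> (r x a)) \<le> (vnorm (dual X) \<phi> * (K * vnorm A a)) * vnorm X x"
      by (simp add: mult.assoc)
  qed (simp_all add: r_add_left r_smult_left dual_carrierD[OF assms(1)] r_closed assms(2))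
qed

lemma dual_right_closed:
  assumes "\<phi> \<in> dual_carrier X" "a \<in> carrier A"
  shows "dual_right X l \<phi> a \<in> dual_carrier X"
proof -
  obtain K where K: "\<And>a x. a \<in> carrier A \<Longrightarrow> x \<in> carrier X \<Longrightarrow> vnorm X (l a x) \<le> K * vnorm A a * vnorm X x"
    using l_bounded by blast
  show ?thesis unfolding dual_right_def
  proof (rule dual_carrierI)
    fix x assume x: "x \<in> carrier X"
    have "cmod (\<phi> (l a x)) \<le> vnorm (dual X) \<phi> * vnorm X (l a x)"
      by (intro dual_norm_bound assms l_closed x)
    also have "\<dots> \<le> vnorm (dual X) \<phi> * (K * vnorm A a * vnorm X x)"
      by (intro mult_left_mono K assms x dual_norm_nonneg)
    finally show "cmod (\<phi> (l a x)) \<le> (vnorm (dual X) \<phi> * (K * vnorm A a)) * vnorm X x"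
      by (simp add: mult.assoc)
  qed (simp_all add: l_add_right l_smult_right dual_carrierD[OF assms(1)] l_closed assms(2))
qed

end

section \<open>Amenability\<close>

context compact_orlicz
begin

lemma amenable_imp_finite:
  assumes "amenable TYPE(('a \<Rightarrow> complex, 'x) bimodule_univ) A"
  shows "finite (UNIV :: 'a set)"
proof -
  let ?C = "continuous_functions :: ('a \<Rightarrow> complex) normed_cmodule"
  interpret C: complex_normed_space ?C
    by (rule continuous_functions_normed_space[OF compact_UNIV])
  interpret dC: complex_banach_space "dual ?C" by (rule C.dual_banach_space)
  define X :: "('a \<Rightarrow> complex, 'x) bimodule_univ normed_cmodule"
    where "X = transport Inl projl (dual ?C)"
  have X: "complex_banach_space X"
    unfolding X_def by (rule dC.transport_banach_space) simp
  interpret X: complex_banach_space X by (rule X)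
  \<comment> \<open>The transpose of the left convolution u -> a * u; transposition reverses the
    order, so this is a right action on \<open>dual ?C\<close>.\<close>
  define act where "act = (\<lambda>a \<xi>. \<lambda>u\<in>carrier ?C. \<xi> (convolution \<mu> a u) :: complex)"
  define l where "l = (\<lambda>(a :: 'a \<Rightarrow> complex) (x :: ('a \<Rightarrow> complex, 'x) bimodule_univ). \<zero>\<^bsub>X\<^esub>)"
  define r where "r = (\<lambda>(x :: ('a \<Rightarrow> complex, 'x) bimodule_univ) a. Inl (act a (projl x)) :: ('a \<Rightarrow> complex, 'x) bimodule_univ)"
  have cont: "continuous_on UNIV a" if "a \<in> carrier A" for a
    using that by (simp add: carrier_A)
  have act_bound: "cmod (\<xi> (convolution \<mu> a u)) \<le> vnorm (dual ?C) \<xi> * (\<integral>y. cmod (a y) \<partial>\<mu>) * vnorm ?C u"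
    if \<xi>: "\<xi> \<in> dual_carrier ?C" and a: "continuous_on UNIV a" and u: "continuous_on UNIV u" for \<xi> a u
  proof -
    have "cmod (\<xi> (convolution \<mu> a u)) \<le> vnorm (dual ?C) \<xi> * vnorm ?C (convolution \<mu> a u)"
      by (rule C.dual_norm_bound[OF \<xi>]) (simp add: continuous_convolution a u)
    also have "\<dots> \<le> vnorm (dual ?C) \<xi> * (vnorm ?C u * (\<integral>y. cmod (a y) \<partial>\<mu>))"
      by (intro mult_left_mono sup_norm_least norm_convolution_le a sup_norm_upper compact_UNIV u
          C.dual_norm_nonneg \<xi>)
    finally show ?thesis by (simp add: ac_simps)
  qed
  have act_closed: "act a \<xi> \<in> dual_carrier ?C" if "\<xi> \<in> dual_carrier ?C" "continuous_on UNIV a" for a \<xi>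
    unfolding act_def
  proof (rule C.dual_carrierI)
    show "cmod (\<xi> (convolution \<mu> a u)) \<le> vnorm (dual ?C) \<xi> * (\<integral>y. cmod (a y) \<partial>\<mu>) * vnorm ?C u"
      if "u \<in> carrier ?C" for u
      using act_bound \<open>\<xi> \<in> _\<close> \<open>continuous_on UNIV a\<close> that by simp
  qed (use that in \<open>simp_all add: convolution_add convolution_scale continuous_convolution
        dual_carrierD(2,3)[OF that(1), simplified]\<close>)
  have act_norm: "vnorm (dual ?C) (act a \<xi>) \<le> vnorm (dual ?C) \<xi> * (\<integral>y. cmod (a y) \<partial>\<mu>)"
    if "\<xi> \<in> dual_carrier ?C" "continuous_on UNIV a" for a \<xi>
  proof (rule C.dual_norm_le)
    show "0 \<le> vnorm (dual ?C) \<xi> * (\<integral>y. cmod (a y) \<partial>\<mu>)"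
      using C.dual_norm_nonneg[OF that(1)] by simp
  qed (use act_bound[OF that] in \<open>simp add: act_def\<close>)
  \<comment> \<open>The L1 norm is dominated by the supremum norm and hence by the norm of
    \<open>A\<close>. This turns the L1 estimate for the action into the boundedness required of a
    Banach bimodule.\<close>
  have L1: "(\<integral>y. cmod (a y) \<partial>\<mu>) \<le> measure \<mu> UNIV * vnorm A a" if "a \<in> carrier A" for a
    using norm_integral_le_const[of "\<lambda>y. cmod (a y)" "vnorm A a"] norm_le_vnorm[OF that]
    by (simp add: mult.commute)
  have "banach_bimodule A X l r"
  proof (intro banach_bimodule.intro X, unfold_locales)
    show "\<exists>K. \<forall>a\<in>carrier A. \<forall>x\<in>carrier X. vnorm X (l a x) \<le> K * vnorm A a * vnorm X x"
      by (rule exI[of _ 0]) (simp add: l_def X.vnorm_zero)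
    show "\<exists>K. \<forall>a\<in>carrier A. \<forall>x\<in>carrier X. vnorm X (r x a) \<le> K * vnorm A a * vnorm X x"
    proof (intro exI[of _ "measure \<mu> UNIV"] ballI)
      fix a x assume a: "a \<in> carrier A" and "x \<in> carrier X"
      then obtain \<xi> where \<xi>: "x = Inl \<xi>" "\<xi> \<in> dual_carrier ?C" by (auto simp: X_def)
      have "vnorm (dual ?C) (act a \<xi>) \<le> vnorm (dual ?C) \<xi> * (measure \<mu> UNIV * vnorm A a)"
        using act_norm[OF \<xi>(2) cont[OF a]]
          mult_left_mono[OF L1[OF a] C.dual_norm_nonneg[OF \<xi>(2)]] by linarith
      then show "vnorm X (r x a) \<le> measure \<mu> UNIV * vnorm A a * vnorm X x"
        by (simp add: X_def r_def \<xi>(1) ac_simps)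
    qed
    fix a b x y c
    assume a: "a \<in> carrier A" and x: "x \<in> carrier X"
    note ca = cont[OF a]
    obtain \<xi> where \<xi>: "x = Inl \<xi>" "\<xi> \<in> dual_carrier ?C" using x by (auto simp: X_def)
    note \<xi>D = dual_carrierD(2,3)[OF \<xi>(2), simplified]
    show "l a x \<in> carrier X" by (simp add: l_def)
    show "l a (c \<odot>\<^bsub>X\<^esub> x) = c \<odot>\<^bsub>X\<^esub> l a x" "l (c \<odot>\<^bsub>A\<^esub> a) x = c \<odot>\<^bsub>X\<^esub> l a x"
      using X.smult_r_null[of c] by (simp_all add: l_def)
    show "r x a \<in> carrier X"
      using act_closed[OF \<xi>(2) ca] by (simp add: r_def \<xi>(1) X_def)
    show "r (c \<odot>\<^bsub>X\<^esub> x) a = c \<odot>\<^bsub>X\<^esub> r x a"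
      using ca by (auto simp: r_def \<xi>(1) X_def act_def continuous_convolution intro!: restrict_ext)
    show "r x (c \<odot>\<^bsub>A\<^esub> a) = c \<odot>\<^bsub>X\<^esub> r x a"
      using ca by (auto simp: r_def \<xi>(1) X_def act_def A_simps convolution_scale continuous_convolution
          \<xi>D intro!: restrict_ext)
    {
      assume y: "y \<in> carrier X"
      show "l a (x \<oplus>\<^bsub>X\<^esub> y) = l a x \<oplus>\<^bsub>X\<^esub> l a y" by (simp add: l_def)
      obtain \<eta> where \<eta>: "y = Inl \<eta>" using y by (auto simp: X_def)
      show "r (x \<oplus>\<^bsub>X\<^esub> y) a = r x a \<oplus>\<^bsub>X\<^esub> r y a"
        using ca by (auto simp: r_def \<xi>(1) \<eta>(1) X_def act_def continuous_convolution intro!: restrict_ext)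
    }
    assume b: "b \<in> carrier A"
    note cb = cont[OF b]
    show "l (a \<oplus>\<^bsub>A\<^esub> b) x = l a x \<oplus>\<^bsub>X\<^esub> l b x" "l (a \<otimes>\<^bsub>A\<^esub> b) x = l a (l b x)"
      by (simp_all add: l_def)
    have "act a \<zero>\<^bsub>dual ?C\<^esub> = \<zero>\<^bsub>dual ?C\<^esub>" if "continuous_on UNIV a" for a
      using that by (auto simp: act_def continuous_convolution intro!: restrict_ext)
    then show "l a (r x b) = r (l a x) b"
      using cb by (simp add: l_def r_def X_def)
    show "r x (a \<oplus>\<^bsub>A\<^esub> b) = r x a \<oplus>\<^bsub>X\<^esub> r x b"
      using ca cb by (auto simp: r_def \<xi>(1) X_def act_def A_simps convolution_add continuous_convolution
          \<xi>D intro!: restrict_ext)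
    show "r x (a \<otimes>\<^bsub>A\<^esub> b) = r (r x a) b"
      using ca cb by (auto simp: r_def \<xi>(1) X_def act_def A_simps convolution_assoc continuous_convolution
          intro!: restrict_ext)
  qed
  \<comment> \<open>Up to the copy, the canonical map into the bidual of \<open>?C\<close>. The zero
    left action on X makes the second term of the derivation rule vanish, so the rule only asks that
    D (a * b) = a . D b.\<close>
  define D where "D = (\<lambda>a :: 'a \<Rightarrow> complex. \<lambda>x\<in>carrier X. projl x a)"
  have D_bound: "cmod (projl x a) \<le> vnorm A a * vnorm X x" if a: "a \<in> carrier A" and x: "x \<in> carrier X" for a x
  proof -
    obtain \<xi> where \<xi>: "x = Inl \<xi>" "\<xi> \<in> dual_carrier ?C" using x by (auto simp: X_def)
    have "cmod (\<xi> a) \<le> vnorm (dual ?C) \<xi> * vnorm ?C a"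
      by (rule C.dual_norm_bound[OF \<xi>(2)]) (simp add: cont a)
    also have "\<dots> \<le> vnorm (dual ?C) \<xi> * vnorm A a"
      by (intro mult_left_mono sup_norm_least norm_le_vnorm a C.dual_norm_nonneg \<xi>)
    finally show ?thesis by (simp add: \<xi>(1) X_def mult.commute)
  qed
  have vnorm_A_nonneg: "0 \<le> vnorm A a" if "a \<in> carrier A" for a
    using norm_le_vnorm[OF that, of undefined] norm_ge_zero order_trans by blast
  have "bounded_derivation A (dual X) (dual_left X r) (dual_right X l) D"
    unfolding bounded_derivation_def
  proof (intro conjI ballI allI)
    show "D \<in> carrier A \<rightarrow> carrier (dual X)"
    proof
      fix a assume a: "a \<in> carrier A"
      have "(\<lambda>x\<in>carrier X. projl x a) \<in> dual_carrier X"
        by (rule X.dual_carrierI[OF _ _ D_bound[OF a]]) (auto simp: X_def cont a)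
      then show "D a \<in> carrier (dual X)" by (simp add: D_def)
    qed
    show "\<exists>K. \<forall>a\<in>carrier A. vnorm (dual X) (D a) \<le> K * vnorm A a"
    proof (intro exI[of _ 1] ballI)
      fix a assume a: "a \<in> carrier A"
      show "vnorm (dual X) (D a) \<le> 1 * vnorm A a"
        by (rule X.dual_norm_le) (use D_bound[OF a] vnorm_A_nonneg[OF a] in \<open>auto simp: D_def\<close>)
    qed
    fix a c assume a: "a \<in> carrier A"
    have lin: "projl x (\<lambda>t. c * a t) = c * projl x a"
      "continuous_on UNIV b \<Longrightarrow> projl x (\<lambda>t. a t + b t) = projl x a + projl x b" if x: "x \<in> carrier X" for x b
    proof -
      obtain \<xi> where \<xi>: "x = Inl \<xi>" "\<xi> \<in> dual_carrier ?C" using x by (auto simp: X_def)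
      show "projl x (\<lambda>t. c * a t) = c * projl x a"
        "continuous_on UNIV b \<Longrightarrow> projl x (\<lambda>t. a t + b t) = projl x a + projl x b"
        using dual_carrierD(2,3)[OF \<xi>(2), simplified] cont[OF a] by (auto simp: \<xi>(1))
    qed
    show "D (c \<odot>\<^bsub>A\<^esub> a) = c \<odot>\<^bsub>dual X\<^esub> D a"
      by (auto simp: D_def A_simps lin intro!: restrict_ext)
    fix b assume b: "b \<in> carrier A"
    show "D (a \<oplus>\<^bsub>A\<^esub> b) = D a \<oplus>\<^bsub>dual X\<^esub> D b"
      by (auto simp: D_def A_simps lin cont[OF b] intro!: restrict_ext)
    show "D (a \<otimes>\<^bsub>A\<^esub> b) = dual_left X r a (D b) \<oplus>\<^bsub>dual X\<^esub> dual_right X l (D a) b"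
    proof -
      have "r x a \<in> carrier X" "projl (r x a) b = projl x (convolution \<mu> a b)" if x: "x \<in> carrier X" for x
        using x act_closed[OF _ cont[OF a]] cont[OF b] by (auto simp: X_def r_def act_def)
      moreover have "projl \<zero>\<^bsub>X\<^esub> a = 0" using cont[OF a] by (simp add: X_def)
      ultimately show ?thesis
        by (auto simp: D_def A_simps dual_left_def dual_right_def l_def intro!: restrict_ext)
    qed
  qed
  with \<open>banach_bimodule A X l r\<close> assms have "inner_derivation A (dual X) (dual_left X r) (dual_right X l) D"
    unfolding amenable_def by blast
  then obtain E where E: "E \<in> dual_carrier X"
    and D_eq: "\<And>a. a \<in> carrier A \<Longrightarrow> D a = dual_left X r a E \<ominus>\<^bsub>dual X\<^esub> dual_right X l E a"
    by (auto simp: inner_derivation_def)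
  have dual_right_zero: "dual_right X l E a = \<zero>\<^bsub>dual X\<^esub>" for a
    using X.dual_at_zero[OF E] by (auto simp: dual_right_def l_def intro!: restrict_ext)
  have D_E: "D a x = E (r x a)" if "a \<in> carrier A" "x \<in> carrier X" for a x
    using that X.dual_zero_closed
    by (simp add: D_eq dual_right_zero X.dual_minus) (simp add: dual_left_def)
  define \<delta> where "\<delta> = (\<lambda>u\<in>carrier ?C. u 0 :: complex)"
  have \<delta>: "\<delta> \<in> dual_carrier ?C"
    unfolding \<delta>_def
    by (rule C.dual_carrierI[of _ 1]) (use sup_norm_upper[OF compact_UNIV] in simp_all)
  then have \<delta>X: "Inl \<delta> \<in> carrier X" by (simp add: X_def)
  let ?K = "vnorm (dual X) E"
  show ?thesis
  proof (rule finite_if_L2_le_L1[of ?K])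
    fix \<phi> :: "'a \<Rightarrow> real"
    assume \<phi>: "continuous_on UNIV \<phi>" "\<And>x. 0 \<le> \<phi> x" "\<And>x. \<phi> (- x) = \<phi> x"
    let ?s = "\<integral>x. (\<phi> x)\<^sup>2 \<partial>\<mu>" and ?t = "\<integral>x. \<phi> x \<partial>\<mu>"
    define f where "f = (\<lambda>x. complex_of_real (\<phi> x))"
    have f: "continuous_on UNIV f" and norm_f: "\<And>x. cmod (f x) = \<phi> x"
      using \<phi> by (auto simp: f_def intro!: continuous_intros)
    define a where "a = convolution \<mu> f f"
    have a: "a \<in> carrier A" "continuous_on UNIV a"
      unfolding a_def by (intro convolution_in_A continuous_convolution f)+
    have "a 0 = of_real ?s"
      using integral_square_eq_convolution[of \<phi>] \<phi>(3) by (simp add: a_def f_def)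
    then have "?s \<le> cmod (a 0)" by simp
    also have "a 0 = E (r (Inl \<delta>) a)"
      using D_E[OF a(1) \<delta>X] \<delta>X a(2) by (simp add: D_def \<delta>_def)
    also have "cmod \<dots> \<le> ?K * vnorm X (r (Inl \<delta>) a)"
      using act_closed[OF \<delta> a(2)] by (intro X.dual_norm_bound E) (simp add: r_def X_def)
    also have "vnorm X (r (Inl \<delta>) a) = vnorm (dual ?C) (act a \<delta>)"
      by (simp add: r_def X_def)
    \<comment> \<open>For a = f * f the functional \<open>act a \<delta>\<close> sends u to the
      value of f * (f * u) at 0, so each factor f contributes its L1 norm.\<close>
    also have "?K * \<dots> \<le> ?K * (?t * ?t)"
    proof (intro mult_left_mono C.dual_norm_le X.dual_norm_nonneg E)
      show "0 \<le> ?t * ?t" by simp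
      fix u assume "u \<in> carrier ?C"
      then have u: "continuous_on UNIV u" by simp
      have "cmod (convolution \<mu> f u x) \<le> vnorm ?C u * ?t" for x
        using norm_convolution_le[OF f sup_norm_upper[OF compact_UNIV u]] by (simp add: norm_f)
      then have "cmod (convolution \<mu> f (convolution \<mu> f u) 0) \<le> vnorm ?C u * ?t * ?t"
        using norm_convolution_le[OF f, of "convolution \<mu> f u"] by (simp add: norm_f)
      then show "cmod (act a \<delta> u) \<le> ?t * ?t * vnorm ?C u"
        using u a(2) by (simp add: act_def \<delta>_def continuous_convolution a_def convolution_assoc f ac_simps)
    qed
    finally show "?s \<le> ?K * ?t\<^sup>2" by (simp add: power2_eq_square)
  qed
qed

end

section \<open>Finite groups\<close>

locale finite_orlicz = compact_orlicz +
  assumes finite_UNIV: "finite (UNIV :: 'a set)"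
begin

text \<open>A finite Hausdorff space is discrete.\<close>

lemma all_continuous: "continuous_on UNIV (f :: 'a \<Rightarrow> 'b::topological_space)"
proof -
  have "open S" for S :: "'a set"
    using finite_imp_closed[OF finite_subset[OF subset_UNIV finite_UNIV], of "- S"]
    by (simp add: open_closed)
  then show ?thesis by (simp add: continuous_on_open_vimage)
qed

text \<open>The common mass of all points. Haar measure is not normalised, so this factor enters
  whenever an integral becomes a sum.\<close>

definition "point_weight = measure \<mu> {0}"

lemma point_weight_pos: "0 < point_weight"
proof -
  have "measure \<mu> UNIV = (\<Sum>x\<in>UNIV. measure \<mu> {x})"
    using finite_UNIV by (intro finite_measure_eq_sum_singleton) (auto simp: sets_eq)
  also have "\<dots> = real (card (UNIV :: 'a set)) * point_weight"
    by (subst sum.cong[OF refl measure_singleton]) (simp add: point_weight_def)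
  finally have "0 < real (card (UNIV :: 'a set)) * point_weight"
    using measure_UNIV_pos by simp
  then show ?thesis by (simp add: zero_less_mult_iff)
qed

lemma integral_eq_sum: "(\<integral>x. f x \<partial>\<mu>) = of_real point_weight * (\<Sum>x\<in>UNIV. f x :: complex)"
proof -
  have "indicator {a} x *\<^sub>R f a = (if a = x then f x else 0)" for a x
    by (simp add: indicator_def)
  then have "f x = (\<Sum>a\<in>UNIV. indicator {a} x *\<^sub>R f a)" for x
    using finite_UNIV by simp
  then have "(\<integral>x. f x \<partial>\<mu>) = (\<integral>x. (\<Sum>a\<in>UNIV. indicator {a} x *\<^sub>R f a) \<partial>\<mu>)"
    by (rule Bochner_Integration.integral_cong[OF refl])
  also have "\<dots> = (\<Sum>a\<in>UNIV. (\<integral>x. indicator {a} x *\<^sub>R f a \<partial>\<mu>))"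
    by (intro Bochner_Integration.integral_sum continuous_integrable all_continuous)
  also have "\<dots> = (\<Sum>a\<in>UNIV. point_weight *\<^sub>R f a)"
  proof (rule sum.cong[OF refl])
    fix a
    show "(\<integral>x. indicator {a} x *\<^sub>R f a \<partial>\<mu>) = point_weight *\<^sub>R f a"
      using measure_singleton[of a] by (simp add: sets_eq emeasure_eq_measure point_weight_def)
  qed
  finally show ?thesis by (simp add: scaleR_conv_of_real sum_distrib_left)
qed

text \<open>The density with respect to \<open>\<mu>\<close> of the unit mass at g. Dividing by the
  weight makes the map from g to \<open>point_mass g\<close> multiplicative for convolution.\<close>

definition point_mass :: "'a \<Rightarrow> 'a \<Rightarrow> complex" where
  "point_mass g = (\<lambda>x. if x = g then 1 / of_real point_weight else 0)"

lemma convolution_point_mass_left: "convolution \<mu> (point_mass g) u x = u (- g + x)"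
proof -
  have "point_mass g y * u (- y + x) = (if y = g then u (- g + x) / of_real point_weight else 0)" for y
    by (simp add: point_mass_def)
  then show ?thesis
    using finite_UNIV point_weight_pos by (simp add: convolution_def integral_eq_sum)
qed

lemma convolution_point_mass_zero: "convolution \<mu> u (point_mass 0) x = u x"
proof -
  have "- y + x = 0 \<longleftrightarrow> y = x" for y
    by (metis add.left_inverse add_left_cancel)
  then have "u y * point_mass 0 (- y + x) = (if y = x then u x / of_real point_weight else 0)" for y
    by (simp add: point_mass_def)
  then show ?thesis
    using finite_UNIV point_weight_pos by (simp add: convolution_def integral_eq_sum)
qed

lemma convolution_point_masses:
  "convolution \<mu> (point_mass g) (point_mass h) = point_mass (g + h)"
proof
  fix x
  have "- g + x = h \<longleftrightarrow> x = g + h" by (metis add.assoc add_0 add.left_inverse add.right_inverse)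
  then show "convolution \<mu> (point_mass g) (point_mass h) x = point_mass (g + h) x"
    unfolding convolution_point_mass_left by (simp add: point_mass_def)
qed

text \<open>\<open>point_mass 0\<close> is a unit for convolution, so every function is itself a
  convolution of two continuous functions.\<close>

lemma in_A: "u \<in> carrier A"
proof -
  have "convolution \<mu> u (point_mass 0) \<in> carrier A"
    by (intro convolution_in_A all_continuous)
  then show ?thesis by (simp add: convolution_point_mass_zero[abs_def])
qed

lemma finite_unital: "unital A"
  unfolding unital_def
  by (rule bexI[of _ "point_mass 0"])
     (auto simp: in_A A_simps convolution_point_mass_left convolution_point_mass_zero)

text \<open>
  The averaged functional \<open>\<Sum>g. \<delta>_g \<cdot> D(\<delta>_(-g)) / card G\<close> implements a derivation if \<open>\<delta>_0\<close> acts as the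
  identity. The modules are not assumed to be unital, hence the correction term \<open>D(\<delta>_0) \<cdot> \<delta>_0\<close>.
\<close>

lemma finite_amenable: "amenable TYPE('b) A"
  unfolding amenable_def
proof (intro allI impI)
  fix X :: "'b normed_cmodule" and l r D
  assume "banach_bimodule A X l r"
  then interpret X: banach_bimodule A X l r .
  assume der: "bounded_derivation A (dual X) (dual_left X r) (dual_right X l) D"
  let ?d = point_mass
  have D: "D a \<in> dual_carrier X" for a
    using der in_A by (auto simp: bounded_derivation_def)
  have D_add: "D (\<lambda>t. a t + b t) x = D a x + D b x" if "x \<in> carrier X" for a b x
  proof -
    have "D (a \<oplus>\<^bsub>A\<^esub> b) = D a \<oplus>\<^bsub>dual X\<^esub> D b"
      using der in_A by (simp add: bounded_derivation_def)
    then show ?thesis using that by (simp add: A_simps)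
  qed
  have D_smult: "D (\<lambda>t. c * a t) x = c * D a x" if "x \<in> carrier X" for a c x
  proof -
    have "D (c \<odot>\<^bsub>A\<^esub> a) = c \<odot>\<^bsub>dual X\<^esub> D a"
      using der in_A by (simp add: bounded_derivation_def)
    then show ?thesis using that by (simp add: A_simps)
  qed
  have D_conv: "D (convolution \<mu> a b) x = D b (r x a) + D a (l b x)" if "x \<in> carrier X" for a b x
  proof -
    have "D (a \<otimes>\<^bsub>A\<^esub> b) = dual_left X r a (D b) \<oplus>\<^bsub>dual X\<^esub> dual_right X l (D a) b"
      using der in_A by (simp add: bounded_derivation_def)
    then show ?thesis using that by (simp add: A_simps dual_left_def dual_right_def)
  qed
  note [simp] = X.l_closed[OF in_A] X.r_closed[OF in_A]
  have r_conv: "r (r x a) b = r x (convolution \<mu> a b)" if "x \<in> carrier X" for a b x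
    using X.r_assoc[OF in_A in_A that, of a b] by (simp add: A_simps)
  have l_conv: "l a (l b x) = l (convolution \<mu> a b) x" if "x \<in> carrier X" for a b x
    using X.l_assoc[OF in_A in_A that, of a b] by (simp add: A_simps)
  define n where "n = complex_of_nat (card (UNIV :: 'a set))"
  have n: "n \<noteq> 0" using finite_UNIV by (simp add: n_def)
  define y0 where "y0 = (\<lambda>x. (1 / n) * (\<Sum>g\<in>UNIV. D (?d (- g)) (r x (?d g))) - D (?d 0) (l (?d 0) x))"
  define y where "y = (\<lambda>x\<in>carrier X. y0 x)"
  have y: "y \<in> dual_carrier X"
  proof -
    let ?s = "\<lambda>x\<in>carrier X. \<Sum>g\<in>UNIV. dual_left X r (?d g) (D (?d (- g))) x"
    have "(\<lambda>x\<in>carrier X. (\<lambda>x\<in>carrier X. (1 / n) * ?s x) x - dual_right X l (D (?d 0)) (?d 0) x)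
        \<in> dual_carrier X"
      by (intro X.dual_minus_closed X.dual_scale_closed X.dual_sum_closed X.dual_left_closed
          X.dual_right_closed D in_A finite_UNIV)
    also have "(\<lambda>x\<in>carrier X. (\<lambda>x\<in>carrier X. (1 / n) * ?s x) x - dual_right X l (D (?d 0)) (?d 0) x) = y"
      by (auto simp: y_def y0_def dual_left_def dual_right_def intro!: restrict_ext)
    finally show ?thesis .
  qed
  have key: "D (?d h) x = y0 (r x (?d h)) - y0 (l (?d h) x)" if x: "x \<in> carrier X" for h x
  proof -
    have "(\<Sum>g\<in>UNIV. D (?d (- g)) (r (r x (?d h)) (?d g)))
        = (\<Sum>g\<in>UNIV. D (?d (- g)) (r x (?d (h + g))))"
      using x by (simp add: r_conv convolution_point_masses)
    \<comment> \<open>Setting k = h + g turns -g into -k + h. The point mass there is the product of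
      those at -k and h, to which the derivation rule applies.\<close>
    also have "\<dots> = (\<Sum>k\<in>UNIV. D (?d (- k + h)) (r x (?d k)))"
      by (rule sum.reindex_bij_witness[of _ "\<lambda>k. - h + k" "\<lambda>g. h + g"]) (simp_all add: minus_add add.assoc)
    also have "\<dots> = (\<Sum>k\<in>UNIV. D (?d h) (r x (?d 0)) + D (?d (- k)) (r (l (?d h) x) (?d k)))"
    proof (rule sum.cong[OF refl])
      fix k
      have "D (?d (- k + h)) (r x (?d k)) = D (?d h) (r (r x (?d k)) (?d (- k))) + D (?d (- k)) (l (?d h) (r x (?d k)))"
        using D_conv[of "r x (?d k)" "?d (- k)" "?d h"] x by (simp add: convolution_point_masses)
      then show "D (?d (- k + h)) (r x (?d k)) = D (?d h) (r x (?d 0)) + D (?d (- k)) (r (l (?d h) x) (?d k))"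
        using x by (simp add: r_conv convolution_point_masses X.l_r_assoc[OF in_A in_A])
    qed
    also have "\<dots> = n * D (?d h) (r x (?d 0)) + (\<Sum>k\<in>UNIV. D (?d (- k)) (r (l (?d h) x) (?d k)))"
      by (simp add: sum.distrib n_def)
    finally have sum: "(\<Sum>g\<in>UNIV. D (?d (- g)) (r (r x (?d h)) (?d g)))
        = n * D (?d h) (r x (?d 0)) + (\<Sum>k\<in>UNIV. D (?d (- k)) (r (l (?d h) x) (?d k)))" .
    \<comment> \<open>The derivation rule for the idempotent \<open>?d 0\<close>, evaluated at
      \<open>r x (?d h)\<close>, which \<open>?d 0\<close> fixes from the right. Hence the
      correction term of \<open>y0\<close> vanishes there.\<close>
    have "D (?d 0) (r x (?d h)) = D (?d 0) (r (r x (?d h)) (?d 0)) + D (?d 0) (l (?d 0) (r x (?d h)))"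
      using D_conv[of "r x (?d h)" "?d 0" "?d 0"] x by (simp add: convolution_point_masses)
    then have zero: "D (?d 0) (l (?d 0) (r x (?d h))) = 0"
      using x by (simp add: r_conv convolution_point_masses)
    \<comment> \<open>\<open>?d h\<close> is written as the product of \<open>?d 0\<close> and
      \<open>?d h\<close>. The average in \<open>y0\<close> produces the first summand, the
      correction term the second.\<close>
    have split: "D (?d h) x = D (?d h) (r x (?d 0)) + D (?d 0) (l (?d h) x)"
      using D_conv[OF x, of "?d 0" "?d h"] by (simp add: convolution_point_masses)
    have "l (?d 0) (l (?d h) x) = l (?d h) x"
      using x by (simp add: l_conv convolution_point_masses)
    then show ?thesis
      using n by (simp add: y0_def sum zero split field_simps)
  qed
  \<comment> \<open>Point masses span all functions, so the identity extends by linearity. The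
    induction runs over the set on which a is retained, all other values being set to 0.\<close>
  have inner: "D a x = y (r x a) - y (l a x)" if x: "x \<in> carrier X" for a x
  proof -
    have "D (\<lambda>t. if t \<in> S then a t else 0) x
        = y (r x (\<lambda>t. if t \<in> S then a t else 0)) - y (l (\<lambda>t. if t \<in> S then a t else 0) x)"
      if "finite S" for S
      using that
    proof (induction S)
      case empty
      \<comment> \<open>The zero function is written as 0 times a, so that the homogeneity of D and
        of both actions applies.\<close>
      have "r x (\<lambda>t. 0 * a t) = 0 \<odot>\<^bsub>X\<^esub> r x a" "l (\<lambda>t. 0 * a t) x = 0 \<odot>\<^bsub>X\<^esub> l a x"
        using X.r_smult_right[OF in_A x, of 0 a] X.l_smult_left[OF in_A x, of 0 a] by (simp_all add: A_simps)
      then show ?case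
        using D_smult[OF x, of 0 a] x by (simp add: dual_carrierD(3)[OF y])
    next
      case (insert h S)
      \<comment> \<open>The factor \<open>point_weight\<close> cancels the normalisation of
        \<open>point_mass\<close>.\<close>
      let ?b = "\<lambda>t. if t \<in> S then a t else 0" and ?c = "of_real point_weight * a h"
      have eq: "(\<lambda>t. if t \<in> insert h S then a t else 0) = (\<lambda>t. ?b t + ?c * ?d h t)"
        using insert.hyps point_weight_pos by (auto simp: point_mass_def)
      have "r x (\<lambda>t. ?b t + ?c * ?d h t) = r x ?b \<oplus>\<^bsub>X\<^esub> ?c \<odot>\<^bsub>X\<^esub> r x (?d h)"
        using X.r_add_right[OF in_A in_A x, of ?b "\<lambda>t. ?c * ?d h t"] X.r_smult_right[OF in_A x, of ?c "?d h"]
        by (simp add: A_simps)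
      moreover have "l (\<lambda>t. ?b t + ?c * ?d h t) x = l ?b x \<oplus>\<^bsub>X\<^esub> ?c \<odot>\<^bsub>X\<^esub> l (?d h) x"
        using X.l_add_left[OF in_A in_A x, of ?b "\<lambda>t. ?c * ?d h t"] X.l_smult_left[OF in_A x, of ?c "?d h"]
        by (simp add: A_simps)
      moreover have "D (\<lambda>t. ?b t + ?c * ?d h t) x = D ?b x + ?c * D (?d h) x"
        using D_add[OF x] D_smult[OF x] by simp
      moreover have "D (?d h) x = y (r x (?d h)) - y (l (?d h) x)"
        using key[OF x] x by (simp add: y_def)
      ultimately show ?case
        unfolding eq using insert.IH x
        by (simp add: dual_carrierD(2,3)[OF y] algebra_simps)
    qed
    from this[OF finite_UNIV] show ?thesis by simp
  qed
  show "inner_derivation A (dual X) (dual_left X r) (dual_right X l) D"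
    unfolding inner_derivation_def
  proof (intro bexI[of _ y] ballI)
    fix a assume "a \<in> carrier A"
    have "D a = (\<lambda>x\<in>carrier X. y (r x a) - y (l a x))"
      using dual_carrierD(1)[OF D] inner by (auto simp: extensional_def)
    also have "\<dots> = (\<lambda>x\<in>carrier X. dual_left X r a y x - dual_right X l y a x)"
      by (intro restrict_ext) (simp add: dual_left_def dual_right_def)
    also have "\<dots> = dual_left X r a y \<ominus>\<^bsub>dual X\<^esub> dual_right X l y a"
      by (rule X.dual_minus[symmetric]) (intro X.dual_right_closed y in_A)
    finally show "D a = dual_left X r a y \<ominus>\<^bsub>dual X\<^esub> dual_right X l y a" .
  qed (simp add: y)
qed

end

theorem corollary3p6:
  fixes \<mu> :: "'a::{topological_group_add, t2_space} measure"
    and \<Phi> :: "real \<Rightarrow> real"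
  assumes "compact (UNIV :: 'a set)"
    and "haar_measure \<mu>"
    and "N_function \<Phi>"
  shows "(has_bounded_approximate_identity (A_Phi \<mu> \<Phi>) \<longleftrightarrow> unital (A_Phi \<mu> \<Phi>)) \<and>
         (unital (A_Phi \<mu> \<Phi>) \<longleftrightarrow> amenable TYPE(('a \<Rightarrow> complex, 'x) bimodule_univ) (A_Phi \<mu> \<Phi>)) \<and>
         (amenable TYPE(('a \<Rightarrow> complex, 'x) bimodule_univ) (A_Phi \<mu> \<Phi>) \<longleftrightarrow> finite (UNIV :: 'a set))"
proof -
  interpret compact_orlicz \<mu> \<Phi>
    by unfold_locales fact+
  have "unital (A_Phi \<mu> \<Phi>)" "amenable TYPE(('a \<Rightarrow> complex, 'x) bimodule_univ) (A_Phi \<mu> \<Phi>)"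
    if "finite (UNIV :: 'a set)"
  proof -
    interpret finite_orlicz \<mu> \<Phi> by unfold_locales fact
    show "unital (A_Phi \<mu> \<Phi>)" "amenable TYPE(('a \<Rightarrow> complex, 'x) bimodule_univ) (A_Phi \<mu> \<Phi>)"
      by (rule finite_unital finite_amenable)+
  qed
  \<comment> \<open>Finiteness implies the other conditions. Conversely, amenability gives it
    directly, and a unit gives it through the bounded approximate identity that it forms.\<close>
  then show ?thesis
    using unital_imp_bounded_approximate_identity bounded_approximate_identity_imp_finite
      amenable_imp_finite[where 'x = 'x] by blast
qed

end
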